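(* Let $n\geq 16$ with $n\equiv 0\pmod 4$, $r=4$, and $t=n-11$. Let $V$ be the set of $n$ vertices $\ell,\nu,\mu,i,b,g,a,d,h,c,e,f_1,\dots,f_t$, and consider the labelled graph on $V$ with edges: label $0$ on $\{\ell,\nu\},\{g,h\},\{a,c\}$; label $1$ on $\{\nu,\mu\},\{h,i\},\{c,b\}$; the edge $\{d,e\}$ carrying the three labels $0,1,3$; label $2$ on $\{a,d\},\{c,e\},\{\mu,i\},\{b,f_1\}$ and on $\{f_s,f_{s+1}\}$ for even $s$ with $1\leq s\leq t-1$; label $3$ on $\{g,a\},\{h,c\},\{i,b\}$ and on $\{f_s,f_{s+1}\}$ for odd $s$ with $1\leq s\leq t-1$. Then $G\cong A_n$ and $(G,(\rho_0,\rho_1,\rho_2,\rho_3))$ is a string C-group of rank 4 with Schläfli type $\{3,12,\mathrm{lcm}(n-8,6)\}$.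
   Context: A string group generated by involutions (sggi) of rank $r$ is a pair $(G,(\rho_0,\dots,\rho_{r-1}))$ where $\rho_0,\dots,\rho_{r-1}$ are involutions generating the group $G$ such that $(\rho_i\rho_j)^2=1$ whenever $|i-j|\geq 2$. It is a string C-group if in addition it satisfies the intersection property: for all $J,K\subseteq\{0,\dots,r-1\}$, $\langle \rho_j : j\in J\rangle\cap\langle\rho_k : k\in K\rangle=\langle \rho_j : j\in J\cap K\rangle$. The Schläfli type is $\{p_1,\dots,p_{r-1}\}$ where $p_i$ is the order of $\rho_{i-1}\rho_i$. Labelled-graph convention: the vertex set $V$ is finite, and each edge $\{a,b\}$ ($a\neq b$) carries one or more labels from $\{0,\dots,r-1\}$, the edges carrying any given label being pairwise disjoint; $\rho_k$ denotes the permutation of $V$ equal to the product of the transpositions $(a\,b)$ over all edges $\{a,b\}$ carrying label $k$, and $G=\langle\rho_0,\dots,\rho_{r-1}\rangle\leq \mathrm{Sym}(V)$. *)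

theory Defs
  imports "HOL-Algebra.Sym_Groups" "HOL-Algebra.Multiplicative_Group"
begin

definition sggi :: "('a, 'b) monoid_scheme \<Rightarrow> (nat \<Rightarrow> 'a) \<Rightarrow> nat \<Rightarrow> bool" where
  "sggi G rho r \<longleftrightarrow> group G
     \<and> (\<forall>i<r. rho i \<in> carrier G \<and> rho i \<otimes>\<^bsub>G\<^esub> rho i = \<one>\<^bsub>G\<^esub> \<and> rho i \<noteq> \<one>\<^bsub>G\<^esub>)
     \<and> generate G (rho ` {..<r}) = carrier G
     \<and> (\<forall>i<r. \<forall>j<r. (i + 2 \<le> j \<or> j + 2 \<le> i) \<longrightarrow>
           (rho i \<otimes>\<^bsub>G\<^esub> rho j) \<otimes>\<^bsub>G\<^esub> (rho i \<otimes>\<^bsub>G\<^esub> rho j) = \<one>\<^bsub>G\<^esub>)"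

definition intersection_property :: "('a, 'b) monoid_scheme \<Rightarrow> (nat \<Rightarrow> 'a) \<Rightarrow> nat \<Rightarrow> bool" where
  "intersection_property G rho r \<longleftrightarrow>
     (\<forall>J K. J \<subseteq> {..<r} \<longrightarrow> K \<subseteq> {..<r} \<longrightarrow>
        generate G (rho ` J) \<inter> generate G (rho ` K) = generate G (rho ` (J \<inter> K)))"

definition string_C_group :: "('a, 'b) monoid_scheme \<Rightarrow> (nat \<Rightarrow> 'a) \<Rightarrow> nat \<Rightarrow> bool" where
  "string_C_group G rho r \<longleftrightarrow> sggi G rho r \<and> intersection_property G rho r"

definition schlafli_type :: "('a, 'b) monoid_scheme \<Rightarrow> (nat \<Rightarrow> 'a) \<Rightarrow> nat \<Rightarrow> nat list" where
  "schlafli_type G rho r = map (\<lambda>i. group.ord G (rho (i - 1) \<otimes>\<^bsub>G\<^esub> rho i)) [1..<r]"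

text \<open>Given the (pairwise disjoint) set E of edges carrying a label, the permutation
  is the product of the transpositions (a b) over all edges {a,b} in E.\<close>
definition label_perm :: "'v set set \<Rightarrow> 'v \<Rightarrow> 'v" where
  "label_perm E x = (if \<exists>y. y \<noteq> x \<and> {x, y} \<in> E then (THE y. y \<noteq> x \<and> {x, y} \<in> E) else x)"

text \<open>Vertices are 1..n: l=1, nu=2, mu=3, i=4, b=5, g=6, a=7, d=8, h=9, c=10, e=11,
  and f_s = 11 + s for 1 <= s <= t = n - 11 (so f_t = n).\<close>

definition thm44_edges :: "nat \<Rightarrow> nat \<Rightarrow> nat set set" where
  "thm44_edges n k =
    (if k = 0 then {{1,2}, {6,9}, {7,10}, {8,11}}
     else if k = 1 then {{2,3}, {9,4}, {10,5}, {8,11}}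
     else if k = 2 then {{7,8}, {10,11}, {3,4}, {5,12}}
            \<union> {{11 + s, 12 + s} | s. even s \<and> 1 \<le> s \<and> s \<le> (n - 11) - 1}
     else if k = 3 then {{6,7}, {9,10}, {4,5}, {8,11}}
            \<union> {{11 + s, 12 + s} | s. odd s \<and> 1 \<le> s \<and> s \<le> (n - 11) - 1}
     else {})"

definition thm44_rho :: "nat \<Rightarrow> nat \<Rightarrow> (nat \<Rightarrow> nat)" where
  "thm44_rho n k = label_perm (thm44_edges n k)"

definition thm44_group :: "nat \<Rightarrow> (nat \<Rightarrow> nat) monoid" where
  "thm44_group n = (sym_group n)\<lparr>carrier := generate (sym_group n) (thm44_rho n ` {..<4})\<rparr>"

end

theory Submission
  imports Defs
begin

text \<open>
  Both \<open>\<rho>\<^sub>2\<close> and \<open>\<rho>\<^sub>3\<close> fix \<open>\<ell>\<close> and \<open>\<nu>\<close>. Hence, once \<open>G\<close> contains one 3-cycle \<open>(\<ell> \<nu> z)\<close>, conjugation by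
  \<open>\<langle>\<rho>\<^sub>2, \<rho>\<^sub>3\<rangle>\<close> yields \<open>(\<ell> \<nu> z')\<close> for all \<open>z'\<close> in the orbit of \<open>z\<close>; this group has only two orbits
  of length greater than one, and \<open>\<rho>\<^sub>1\<close> links them, so \<open>G\<close> contains all 3-cycles. A first 3-cycle is
  the square of a product of two conjugates of \<open>\<rho>\<^sub>1\<close>.

  For the intersection property it suffices to remove the extreme indices one at a time. An element
  of a proper parabolic subgroup that fixes \<open>\<ell>\<close> can be written without \<open>\<rho>\<^sub>0\<close>; the essential case is
  \<open>\<langle>\<rho>\<^sub>0, \<rho>\<^sub>1, \<rho>\<^sub>2\<rangle>\<close>, in which \<open>\<langle>\<rho>\<^sub>1, \<rho>\<^sub>2\<rangle>\<close> is the stabilizer of \<open>\<ell>\<close>, of index 6. An element that also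
  lies in \<open>\<langle>\<rho>\<^sub>0, \<rho>\<^sub>1, \<rho>\<^sub>2\<rangle>\<close> can be written without \<open>\<rho>\<^sub>3\<close>, since it preserves the orbit
  \<open>{\<ell>, \<nu>, \<mu>, i, h, g}\<close> of that group: in the dihedral group \<open>\<langle>\<rho>\<^sub>2, \<rho>\<^sub>3\<rangle>\<close> only \<open>1\<close> and \<open>\<rho>\<^sub>2\<close> do.
\<close>

(* Keeps the vertex 1 a numeral, so that the evaluation tables below match. *)
declare One_nat_def [simp del]

section \<open>Groups generated by involutive functions\<close>

text \<open>Words are taken without inverses because the generators considered are involutions. No
  monoid is mentioned, so the same set describes the generated subgroup in \<open>sym_group\<close>
  and in \<open>alt_group\<close>.\<close>

definition products :: "('a \<Rightarrow> 'a) set \<Rightarrow> ('a \<Rightarrow> 'a) set" where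
  "products S = (\<lambda>ws. foldr (\<circ>) ws id) ` lists S"

lemma products_id: "id \<in> products S"
  unfolding products_def by (rule image_eqI[of _ _ "[]"]) auto

lemma products_step:
  assumes "s \<in> S" "w \<in> products S"
  shows "s \<circ> w \<in> products S"
proof -
  obtain ws where "ws \<in> lists S" "w = foldr (\<circ>) ws id"
    using assms(2) unfolding products_def by blast
  with assms(1) show ?thesis
    unfolding products_def by (intro image_eqI[of _ _ "s # ws"]) auto
qed

lemma products_induct:
  assumes "w \<in> products S" "P id"
    and step: "\<And>s w. s \<in> S \<Longrightarrow> w \<in> products S \<Longrightarrow> P w \<Longrightarrow> P (s \<circ> w)"
  shows "P w"
proof -
  have "P (foldr (\<circ>) ws id)" if "ws \<in> lists S" for ws
    using that
  proof (induction ws)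
    case (Cons s ws)
    then have "foldr (\<circ>) ws id \<in> products S" unfolding products_def by blast
    with Cons have "P (s \<circ> foldr (\<circ>) ws id)" using step by blast
    then show ?case unfolding foldr.simps o_apply .
  qed (use assms(2) in \<open>simp add: id_def\<close>)
  with assms(1) show ?thesis unfolding products_def by blast
qed

lemma products_incl: "s \<in> S \<Longrightarrow> s \<in> products S"
  using products_step[of s S id] products_id[of S] by simp

lemma products_comp:
  assumes "v \<in> products S" "w \<in> products S"
  shows "v \<circ> w \<in> products S"
  using assms(1)
proof (rule products_induct)
  show "id \<circ> w \<in> products S" using assms(2) by simp
  show "s \<circ> v \<circ> w \<in> products S" if "s \<in> S" "v \<circ> w \<in> products S" for s v
    unfolding comp_assoc using that by (rule products_step)
qed

lemma products_mono:
  assumes "S \<subseteq> T" "w \<in> products S"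
  shows "w \<in> products T"
  using assms(2)
  by (rule products_induct) (use assms(1) in \<open>blast intro: products_id products_step\<close>)+

lemma products_invariant:
  assumes "w \<in> products S" "\<And>s x. s \<in> S \<Longrightarrow> s x \<in> A \<longleftrightarrow> x \<in> A"
  shows "w x \<in> A \<longleftrightarrow> x \<in> A"
  using assms(1) by (rule products_induct) (simp_all add: assms(2))

lemma products_fix:
  assumes "w \<in> products S" "\<And>s. s \<in> S \<Longrightarrow> s x = x"
  shows "w x = x"
  using assms(1) by (rule products_induct) (simp_all add: assms(2))

lemma products_bij:
  assumes "w \<in> products S" "\<And>s. s \<in> S \<Longrightarrow> s \<circ> s = id"
  shows "bij w"
  using assms(1)
proof (rule products_induct)
  show "bij (s \<circ> w)" if "s \<in> S" "bij w" for s w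
    using that assms(2) o_bij bij_comp by blast
  show "bij (id :: 'a \<Rightarrow> 'a)" by simp
qed

text \<open>A generator that commutes with all others can be collected at the front of a word, where
  its powers reduce modulo 2.\<close>

lemma products_insert_commute:
  assumes "w \<in> products (insert s S)" "s \<circ> s = id" "\<And>t. t \<in> S \<Longrightarrow> t \<circ> s = s \<circ> t"
  shows "w \<in> products S \<or> (\<exists>y \<in> products S. w = s \<circ> y)"
  using assms(1)
proof (rule products_induct)
  fix t w
  assume t: "t \<in> insert s S" and IH: "w \<in> products S \<or> (\<exists>y \<in> products S. w = s \<circ> y)"
  have "t \<circ> (s \<circ> y) = s \<circ> (t \<circ> y)" if "t \<in> S" for y :: "'a \<Rightarrow> 'a"
    using assms(3)[OF that] by (metis comp_assoc)
  moreover have "s \<circ> (s \<circ> y) = y" for y :: "'a \<Rightarrow> 'a"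
    using assms(2) by (metis comp_assoc id_comp)
  ultimately show "t \<circ> w \<in> products S \<or> (\<exists>y \<in> products S. t \<circ> w = s \<circ> y)"
    using t IH products_step[of t S] by (metis insertE)
next
  show "id \<in> products S \<or> (\<exists>y \<in> products S. id = s \<circ> y)"
    using products_id by blast
qed

text \<open>Each generator is its own inverse, so closing under inverses adds nothing to the
  words.\<close>

lemma generate_eq_products:
  assumes "group G" "mult G = (\<circ>)" "one G = id" "S \<subseteq> carrier G"
    and inv: "\<And>s. s \<in> S \<Longrightarrow> s \<circ> s = id"
  shows "generate G S = products S"
proof
  interpret group G by fact
  show "generate G S \<subseteq> products S"
  proof
    fix x assume "x \<in> generate G S"
    then show "x \<in> products S"
    proof (rule generate.induct)
      show "inv\<^bsub>G\<^esub> h \<in> products S" if "h \<in> S" for h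
      proof -
        have "inv\<^bsub>G\<^esub> h = h"
          using assms that by (intro inv_equality) auto
        with that show ?thesis by (simp add: products_incl)
      qed
      show "\<one>\<^bsub>G\<^esub> \<in> products S" unfolding assms(3) by (rule products_id)
      show "h \<otimes>\<^bsub>G\<^esub> h' \<in> products S" if "h \<in> products S" "h' \<in> products S" for h h'
        unfolding assms(2) using that by (rule products_comp)
    qed (rule products_incl)
  qed
  show "products S \<subseteq> generate G S"
  proof
    fix x assume "x \<in> products S"
    then show "x \<in> generate G S"
    proof (rule products_induct)
      show "id \<in> generate G S" using generate.one[of G S] assms(3) by simp
      show "s \<circ> w \<in> generate G S" if "s \<in> S" "w \<in> generate G S" for s w
        using generate.eng[OF generate.incl[OF that(1)] that(2)] assms(2) by simp
    qed
  qed
qed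

section \<open>Cycles of a function and words in two involutions\<close>

lemma funpow_cycle:
  assumes "\<And>i. i < L \<Longrightarrow> f (c i) = c (Suc i mod L)" "i < L"
  shows "(f ^^ m) (c i) = c ((i + m) mod L)"
proof (induction m)
  case (Suc m)
  have "(f ^^ Suc m) (c i) = f (c ((i + m) mod L))"
    using Suc by simp
  also have "\<dots> = c (Suc ((i + m) mod L) mod L)"
    by (rule assms(1)) (use assms(2) in simp)
  finally show ?case by (simp add: mod_Suc_eq)
qed (use assms in simp)

lemma funpow_cycle_eq_iff:
  assumes "\<And>i. i < L \<Longrightarrow> f (c i) = c (Suc i mod L)" "inj_on c {..<L}" "0 < L"
  shows "(f ^^ m) (c 0) = c 0 \<longleftrightarrow> L dvd m"
proof -
  have "(f ^^ m) (c 0) = c (m mod L)"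
    using funpow_cycle[of L f c 0 m, OF assms(1)] assms(3) by simp
  moreover have "c (m mod L) = c 0 \<longleftrightarrow> m mod L = 0"
    using assms(2,3) by (intro inj_on_eq_iff[of c "{..<L}"]) auto
  ultimately show ?thesis by (simp add: mod_eq_0_iff_dvd)
qed

text \<open>Normal form in a finite dihedral group: rotations, and rotations times one fixed
  reflection.\<close>

lemma products_two_involutions:
  assumes "w \<in> products {a, b}" "a \<circ> a = id" "b \<circ> b = id" "((a \<circ> b) ^^ L) = id" "0 < L"
  shows "\<exists>m. w = (a \<circ> b) ^^ m \<or> w = (a \<circ> b) ^^ m \<circ> a"
proof -
  let ?f = "a \<circ> b"
  have aa: "a (a x) = x" and bb: "b (b x) = x" for x
    using assms(2,3) by (simp_all add: fun_eq_iff)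
  \<comment> \<open>The reflection inverts rotations. Exponents are natural numbers, so the power
    with exponent -m is written with exponent \<open>m * L - m\<close>; the subtraction is exact
    because \<open>0 < L\<close>.\<close>
  have flip: "a \<circ> ?f ^^ m = ?f ^^ (m * L - m) \<circ> a" for m
  proof -
    have 1: "?f ^^ m \<circ> a \<circ> ?f ^^ m = a" for m
    proof (induction m)
      case (Suc m)
      have "?f ^^ Suc m \<circ> a \<circ> ?f ^^ Suc m = (?f ^^ m \<circ> ?f) \<circ> a \<circ> (?f \<circ> ?f ^^ m)"
        by (rule arg_cong2[where f = "\<lambda>p q. p \<circ> a \<circ> q", OF funpow_Suc_right funpow.simps(2)])
      also have "\<dots> = ?f ^^ m \<circ> (?f \<circ> a \<circ> ?f) \<circ> ?f ^^ m"
        by (simp only: comp_assoc)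
      also have "?f \<circ> a \<circ> ?f = a"
        by (simp add: fun_eq_iff aa bb)
      finally show ?case unfolding Suc.IH .
    qed (simp add: fun_eq_iff)
    have "?f ^^ (m * L) = id"
      using funpow_mult[where m = L and n = m and f = ?f] assms(4) by (simp add: mult.commute)
    moreover have "m * L - m + m = m * L" using \<open>0 < L\<close> by simp
    ultimately have 2: "?f ^^ (m * L - m) \<circ> ?f ^^ m = id"
      using funpow_add[of "m * L - m" m ?f] by simp
    have "a \<circ> ?f ^^ m = ?f ^^ (m * L - m) \<circ> ?f ^^ m \<circ> (a \<circ> ?f ^^ m)"
      unfolding 2 by simp
    also have "\<dots> = ?f ^^ (m * L - m) \<circ> (?f ^^ m \<circ> a \<circ> ?f ^^ m)"
      by (simp only: comp_assoc)
    finally show ?thesis unfolding 1 .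
  qed
  define Q where "Q w \<longleftrightarrow> (\<exists>m. w = ?f ^^ m \<or> w = ?f ^^ m \<circ> a)" for w
  have Q: "Q w" if "w = ?f ^^ m \<or> w = ?f ^^ m \<circ> a" for m w
    unfolding Q_def using that by (rule exI[of _ m])
  have by_f: "Q (?f \<circ> w)" if Qw: "Q w" for w
  proof -
    obtain m where m: "w = ?f ^^ m \<or> w = ?f ^^ m \<circ> a"
      using Qw unfolding Q_def by (rule exE)
    then have "?f \<circ> w = ?f ^^ Suc m \<or> ?f \<circ> w = ?f ^^ Suc m \<circ> a"
      by (elim disjE) (simp_all add: comp_assoc)
    then show ?thesis by (rule Q[of _ "Suc m"])
  qed
  have by_a: "Q (a \<circ> w)" if Qw: "Q w" for w
  proof -
    obtain m where m: "w = ?f ^^ m \<or> w = ?f ^^ m \<circ> a"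
      using Qw unfolding Q_def by (rule exE)
    have "a \<circ> (?f ^^ m \<circ> a) = ?f ^^ (m * L - m)"
      unfolding comp_assoc[symmetric] flip unfolding comp_assoc assms(2) by simp
    with m have "a \<circ> w = ?f ^^ (m * L - m) \<or> a \<circ> w = ?f ^^ (m * L - m) \<circ> a"
      using flip[of m] by (elim disjE) (simp_all only: simp_thms)
    then show ?thesis by (rule Q[of _ "m * L - m"])
  qed
  have "Q w" using assms(1)
  proof (rule products_induct)
    show "Q id" by (rule Q[of _ 0]) simp
  next
    fix s w
    assume s: "s \<in> {a, b}" and Qw: "Q w"
    \<comment> \<open>Left multiplication by \<open>b\<close> is left multiplication by the rotation
      and then by \<open>a\<close>.\<close>
    have "b \<circ> w = a \<circ> (?f \<circ> w)" by (simp add: fun_eq_iff aa)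
    then show "Q (s \<circ> w)" using s by_a[OF Qw] by_a[OF by_f[OF Qw]] by auto
  qed
  then show ?thesis unfolding Q_def .
qed

section \<open>The four permutations\<close>

text \<open>The product of the \<open>k\<close> disjoint transpositions (a a+1), (a+2 a+3), and so
  on. The closed form reduces evaluation at a symbolic vertex to parity.\<close>

definition swaps :: "nat \<Rightarrow> nat \<Rightarrow> nat \<Rightarrow> nat" where
  "swaps a k x = (if a \<le> x \<and> x < a + 2 * k then if even (x - a) then x + 1 else x - 1 else x)"

lemma swaps_Suc: "swaps a (Suc k) = swaps a k \<circ> transpose (a + 2 * k) (a + 2 * k + 1)"
proof
  fix x
  consider "x < a" | "x = a + 2 * k" | "x = a + 2 * k + 1" | "a + 2 * k + 2 \<le> x"
    | "a \<le> x" "x < a + 2 * k"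
    by linarith
  then show "swaps a (Suc k) x = (swaps a k \<circ> transpose (a + 2 * k) (a + 2 * k + 1)) x"
    by cases (auto simp: swaps_def transpose_def)
qed

lemma swaps_swaps [simp]: "swaps a k (swaps a k x) = x"
proof (cases "a \<le> x \<and> x < a + 2 * k")
  case True
  then obtain y where y: "x = a + y" "y < 2 * k"
    by (metis add_less_cancel_left le_iff_add)
  show ?thesis
  proof (cases "even y")
    case True
    with y have "y + 1 < 2 * k" by presburger
    with True y show ?thesis by (simp add: swaps_def)
  next
    case False
    then obtain z where "y = 2 * z + 1" by (elim oddE)
    with y show ?thesis by (simp add: swaps_def)
  qed
qed (auto simp: swaps_def)

lemma swaps_permutes: "swaps a k permutes {a..<a + 2 * k}"
proof (rule inj_imp_permutes)
  show "inj_on (swaps a k) {a..<a + 2 * k}"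
    by (rule inj_on_inverseI[of _ "swaps a k"]) simp
  show "swaps a k x \<in> {a..<a + 2 * k}" if "x \<in> {a..<a + 2 * k}" for x
    using that unfolding swaps_def by (auto; presburger)
qed (auto simp: swaps_def)

lemma sign_swaps: "sign (swaps a k) = (-1) ^ k"
proof (induction k)
  case 0
  have "swaps a 0 = id" by (auto simp: swaps_def)
  then show ?case by simp
next
  case (Suc k)
  have "permutation (swaps a k)"
    using swaps_permutes finite_atLeastLessThan unfolding permutation_permutes by blast
  then have "sign (swaps a (Suc k)) = sign (swaps a k) * sign (transpose (a + 2 * k) (a + 2 * k + 1))"
    unfolding swaps_Suc by (intro sign_compose) (auto intro: permutation_swap_id)
  then show ?case
    using Suc by (simp add: sign_swap_id)
qed

text \<open>Here \<open>n = 2 * k + 12\<close>: on the path of the \<open>f\<^sub>s\<close>, labels 2 and 3 each carry \<open>k\<close> edges, starting at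
  \<open>f\<^sub>2 = 13\<close> and \<open>f\<^sub>1 = 12\<close>.\<close>

definition r0 :: "nat \<Rightarrow> nat" where
  "r0 = transpose 1 2 \<circ> transpose 6 9 \<circ> transpose 7 10 \<circ> transpose 8 11"

definition r1 :: "nat \<Rightarrow> nat" where
  "r1 = transpose 2 3 \<circ> transpose 9 4 \<circ> transpose 10 5 \<circ> transpose 8 11"

definition r2 :: "nat \<Rightarrow> nat \<Rightarrow> nat" where
  "r2 k = transpose 7 8 \<circ> transpose 10 11 \<circ> transpose 3 4 \<circ> transpose 5 12 \<circ> swaps 13 k"

definition r3 :: "nat \<Rightarrow> nat \<Rightarrow> nat" where
  "r3 k = transpose 6 7 \<circ> transpose 9 10 \<circ> transpose 4 5 \<circ> transpose 8 11 \<circ> swaps 12 k"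

text \<open>All irregular edges lie on vertices up to 12, where evaluation tables apply; from 13 on
  every label follows the path. Vertex 12 is listed because label 2 joins it to vertex 5.\<close>

lemma nat_cases_13:
  fixes x :: nat
  assumes "P 0" "P 1" "P 2" "P 3" "P 4" "P 5" "P 6" "P 7" "P 8" "P 9" "P 10" "P 11" "P 12"
    "\<And>y. 13 \<le> y \<Longrightarrow> P y"
  shows "P x"
proof (cases "13 \<le> x")
  case False
  then have "x = 0 \<or> x = 1 \<or> x = 2 \<or> x = 3 \<or> x = 4 \<or> x = 5 \<or> x = 6 \<or> x = 7 \<or> x = 8 \<or> x = 9
    \<or> x = 10 \<or> x = 11 \<or> x = 12"
    by presburger
  with assms show ?thesis by blast
qed (rule assms)

lemma r0_simps [simp]:
  "r0 0 = 0" "r0 1 = 2" "r0 2 = 1" "r0 3 = 3" "r0 4 = 4" "r0 5 = 5" "r0 6 = 9" "r0 7 = 10"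
  "r0 8 = 11" "r0 9 = 6" "r0 10 = 7" "r0 11 = 8" "12 \<le> x \<Longrightarrow> r0 x = x"
  by (simp_all add: r0_def transpose_def)

lemma r1_simps [simp]:
  "r1 0 = 0" "r1 1 = 1" "r1 2 = 3" "r1 3 = 2" "r1 4 = 9" "r1 5 = 10" "r1 6 = 6" "r1 7 = 7"
  "r1 8 = 11" "r1 9 = 4" "r1 10 = 5" "r1 11 = 8" "12 \<le> x \<Longrightarrow> r1 x = x"
  by (simp_all add: r1_def transpose_def)

lemma r2_simps [simp]:
  "r2 k 0 = 0" "r2 k 1 = 1" "r2 k 2 = 2" "r2 k 3 = 4" "r2 k 4 = 3" "r2 k 5 = 12" "r2 k 6 = 6"
  "r2 k 7 = 8" "r2 k 8 = 7" "r2 k 9 = 9" "r2 k 10 = 11" "r2 k 11 = 10" "r2 k 12 = 5"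
  by (simp_all add: r2_def transpose_def swaps_def)

lemma r3_simps [simp]:
  "r3 k 0 = 0" "r3 k 1 = 1" "r3 k 2 = 2" "r3 k 3 = 3" "r3 k 4 = 5" "r3 k 5 = 4" "r3 k 6 = 7"
  "r3 k 7 = 6" "r3 k 8 = 11" "r3 k 9 = 10" "r3 k 10 = 9" "r3 k 11 = 8"
  by (simp_all add: r3_def transpose_def swaps_def)

lemma swaps_ge: "a \<le> x \<Longrightarrow> a \<le> swaps a k x"
  unfolding swaps_def by (auto; presburger)

lemma r2_tail: "13 \<le> x \<Longrightarrow> r2 k x = swaps 13 k x"
  using swaps_ge[of 13 x k] by (simp add: r2_def transpose_def)

lemma r3_tail: "12 \<le> x \<Longrightarrow> r3 k x = swaps 12 k x"
  using swaps_ge[of 12 x k] by (simp add: r3_def transpose_def)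

text \<open>The bound \<open>m\<close> is left free so that simplification can discharge side
  conditions such as \<open>12 \<le> r2 k x\<close> in the tables for \<open>r0\<close> and
  \<open>r1\<close>.\<close>

lemma r2_tail_ge [simp]: "13 \<le> x \<Longrightarrow> m \<le> 13 \<Longrightarrow> m \<le> r2 k x"
  using swaps_ge[of 13 x k] by (simp add: r2_tail)

lemma r3_tail_ge [simp]: "12 \<le> x \<Longrightarrow> m \<le> 12 \<Longrightarrow> m \<le> r3 k x"
  using swaps_ge[of 12 x k] by (simp add: r3_tail)

lemma r0_r0 [simp]: "r0 (r0 x) = x"
  by (induction x rule: nat_cases_13) simp_all

lemma r1_r1 [simp]: "r1 (r1 x) = x"
  by (induction x rule: nat_cases_13) simp_all

lemma r2_r2 [simp]: "r2 k (r2 k x) = x"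
  by (induction x rule: nat_cases_13) (simp_all add: r2_tail swaps_ge)

lemma r3_r3 [simp]: "r3 k (r3 k x) = x"
  by (induction x rule: nat_cases_13) (simp_all add: r3_tail swaps_ge)

lemma r0_r2: "r0 (r2 k x) = r2 k (r0 x)"
  by (induction x rule: nat_cases_13) simp_all

lemma r0_r3: "r0 (r3 k x) = r3 k (r0 x)"
  by (induction x rule: nat_cases_13) simp_all

lemma r1_r3: "r1 (r3 k x) = r3 k (r1 x)"
  by (induction x rule: nat_cases_13) simp_all

text \<open>Indices from 4 on give the identity, which is also the permutation of an empty edge set;
  hence the equality with \<open>thm44_rho\<close> is one of functions.\<close>

definition rho :: "nat \<Rightarrow> nat \<Rightarrow> nat \<Rightarrow> nat" where
  "rho k j = (if j = 0 then r0 else if j = 1 then r1 else if j = 2 then r2 k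
     else if j = 3 then r3 k else id)"

lemma rho_simps [simp]: "rho k 0 = r0" "rho k 1 = r1" "rho k 2 = r2 k" "rho k 3 = r3 k"
  by (simp_all add: rho_def)

lemma rho_rho: "rho k j \<circ> rho k j = id"
  by (auto simp: rho_def)

text \<open>\<open>A\<close> picks an end of each edge. Since \<open>f\<close> is an involution, the
  edge at a moved vertex \<open>x\<close> can only be \<open>{x, f x}\<close>, which settles the
  definite description.\<close>

lemma label_perm_eqI:
  assumes E: "E = (\<lambda>x. {x, f x}) ` A"
    and inv: "\<And>x. f (f x) = x"
    and moved: "\<And>x. f x \<noteq> x \<Longrightarrow> x \<in> A \<or> f x \<in> A"
  shows "label_perm E = f"
proof
  fix x
  have *: "y = f x" if "y \<noteq> x" and xy: "{x, y} \<in> E" for y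
  proof -
    obtain a where "{x, y} = {a, f a}" using xy unfolding E by blast
    then have "x = a \<and> y = f a \<or> x = f a \<and> y = a" by (auto simp: doubleton_eq_iff)
    then show ?thesis using inv[of a] by auto
  qed
  show "label_perm E x = f x"
  proof (cases "f x = x")
    case True
    then have "\<not> (\<exists>y. y \<noteq> x \<and> {x, y} \<in> E)" using * by metis
    then show ?thesis using True by (simp only: label_perm_def if_False)
  next
    case False
    then have "{x, f x} \<in> E"
      using moved[OF False] inv[of x] unfolding E
      by (auto intro: image_eqI[of _ _ x] image_eqI[of _ _ "f x"])
    with False have fx: "f x \<noteq> x \<and> {x, f x} \<in> E" by simp
    have "(THE y. y \<noteq> x \<and> {x, y} \<in> E) = f x"
      by (rule the_equality) (use fx * in blast)+
    with fx show ?thesis by (auto simp: label_perm_def)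
  qed
qed

lemma thm44_rho_eq: "thm44_rho (2 * k + 12) = rho k"
proof
  fix j
  have 0: "label_perm {{1,2}, {6,9}, {7,10}, {8,11}} = r0"
  proof (rule label_perm_eqI[where A = "{1, 6, 7, 8}"])
    show "x \<in> {1, 6, 7, 8} \<or> r0 x \<in> {1, 6, 7, 8}" if "r0 x \<noteq> x" for x
      using that by (induction x rule: nat_cases_13) simp_all
  qed simp_all
  have 1: "label_perm {{2,3}, {9,4}, {10,5}, {8,11}} = r1"
  proof (rule label_perm_eqI[where A = "{2, 9, 10, 8}"])
    show "x \<in> {2, 9, 10, 8} \<or> r1 x \<in> {2, 9, 10, 8}" if "r1 x \<noteq> x" for x
      using that by (induction x rule: nat_cases_13) simp_all
  qed simp_all
  have 2: "label_perm ({{7,8}, {10,11}, {3,4}, {5,12}}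
    \<union> {{11 + s, 12 + s} | s. even s \<and> 1 \<le> s \<and> s \<le> 2 * k}) = r2 k"
  proof (rule label_perm_eqI)
    let ?A = "\<lambda>s. 11 + s" and ?S = "{s. even s \<and> 1 \<le> s \<and> s \<le> 2 * k}"
    have "r2 k (11 + s) = 12 + s" if "s \<in> ?S" for s
    proof -
      from that have s: "1 \<le> s" "even s" "s \<le> 2 * k" by simp_all
      then have "2 \<le> s" by presburger
      with s show ?thesis by (simp add: r2_tail swaps_def)
    qed
    then have tl: "(\<lambda>x. {x, r2 k x}) ` ?A ` ?S = (\<lambda>s. {11 + s, 12 + s}) ` ?S"
      unfolding image_image by (intro image_cong) auto
    have hd: "(\<lambda>x. {x, r2 k x}) ` {7, 10, 3, 5} = {{7,8}, {10,11}, {3,4}, {5,12}}"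
      by simp
    show "{{7,8}, {10,11}, {3,4}, {5,12}}
        \<union> {{11 + s, 12 + s} | s. even s \<and> 1 \<le> s \<and> s \<le> 2 * k}
      = (\<lambda>x. {x, r2 k x}) ` ({7, 10, 3, 5} \<union> ?A ` ?S)"
      unfolding image_Un hd tl setcompr_eq_image by (rule refl)
    \<comment> \<open>Label 2 on the path uses even \<open>s\<close>, so an odd \<open>y\<close> is
      the lower end \<open>11 + s\<close> of its edge and an even \<open>y\<close> the upper end
      \<open>12 + s\<close>.\<close>
    have tail: "y \<in> ?A ` ?S \<or> r2 k y \<in> ?A ` ?S" if "r2 k y \<noteq> y" "13 \<le> y" for y
    proof -
      have y: "13 \<le> y" "y < 13 + 2 * k" using that by (auto simp: r2_tail swaps_def split: if_splits)
      show ?thesis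
      proof (cases "odd y")
        case True
        with y have "y = 11 + (y - 11)" "y - 11 \<in> ?S"
          unfolding mem_Collect_eq by presburger+
        then show ?thesis by blast
      next
        case False
        with y have "y - 12 \<in> ?S"
          unfolding mem_Collect_eq by presburger
        moreover have "r2 k y = 11 + (y - 12)"
          using y False by (simp add: r2_tail swaps_def)
        ultimately show ?thesis by blast
      qed
    qed
    show "x \<in> {7, 10, 3, 5} \<union> ?A ` ?S \<or> r2 k x \<in> {7, 10, 3, 5} \<union> ?A ` ?S" if "r2 k x \<noteq> x" for x
      using that tail[of x] by (induction x rule: nat_cases_13) (simp_all, blast+)
  qed simp
  have 3: "label_perm ({{6,7}, {9,10}, {4,5}, {8,11}}
    \<union> {{11 + s, 12 + s} | s. odd s \<and> 1 \<le> s \<and> s \<le> 2 * k}) = r3 k"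
  proof (rule label_perm_eqI)
    let ?A = "\<lambda>s. 11 + s" and ?S = "{s. odd s \<and> 1 \<le> s \<and> s \<le> 2 * k}"
    have "r3 k (11 + s) = 12 + s" if "s \<in> ?S" for s
    proof -
      from that have "1 \<le> s" "odd s" "s < 2 * k + 1" by simp_all
      then show ?thesis by (simp add: r3_tail swaps_def)
    qed
    then have tl: "(\<lambda>x. {x, r3 k x}) ` ?A ` ?S = (\<lambda>s. {11 + s, 12 + s}) ` ?S"
      unfolding image_image by (intro image_cong) auto
    have hd: "(\<lambda>x. {x, r3 k x}) ` {6, 9, 4, 8} = {{6,7}, {9,10}, {4,5}, {8,11}}"
      by simp
    show "{{6,7}, {9,10}, {4,5}, {8,11}}
        \<union> {{11 + s, 12 + s} | s. odd s \<and> 1 \<le> s \<and> s \<le> 2 * k}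
      = (\<lambda>x. {x, r3 k x}) ` ({6, 9, 4, 8} \<union> ?A ` ?S)"
      unfolding image_Un hd tl setcompr_eq_image by (rule refl)
    \<comment> \<open>Label 3 uses odd \<open>s\<close>: the parities are exchanged, and the path
      part starts at 12.\<close>
    have tail: "y \<in> ?A ` ?S \<or> r3 k y \<in> ?A ` ?S" if "r3 k y \<noteq> y" "12 \<le> y" for y
    proof -
      have y: "12 \<le> y" "y < 12 + 2 * k" using that by (auto simp: r3_tail swaps_def split: if_splits)
      show ?thesis
      proof (cases "even y")
        case True
        with y have "y = 11 + (y - 11)" "y - 11 \<in> ?S"
          unfolding mem_Collect_eq by presburger+
        then show ?thesis by blast
      next
        case False
        with y have "y - 12 \<in> ?S"
          unfolding mem_Collect_eq by presburger
        moreover have "r3 k y = 11 + (y - 12)"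
          using y False by (simp add: r3_tail swaps_def)
        ultimately show ?thesis by blast
      qed
    qed
    show "x \<in> {6, 9, 4, 8} \<union> ?A ` ?S \<or> r3 k x \<in> {6, 9, 4, 8} \<union> ?A ` ?S" if "r3 k x \<noteq> x" for x
      using that tail[of x] by (induction x rule: nat_cases_13) (simp_all, blast+)
  qed simp
  have "label_perm {} = (id :: nat \<Rightarrow> nat)" by (simp add: label_perm_def fun_eq_iff)
  with 0 1 2 3 show "thm44_rho (2 * k + 12) j = rho k j"
    by (simp add: thm44_rho_def thm44_edges_def rho_def)
qed

lemma rho_permutes: "rho k j permutes {1..2 * k + 12}"
proof -
  have "swaps 12 k permutes {1..2 * k + 12}" "swaps 13 k permutes {1..2 * k + 12}"
    by (auto intro: permutes_subset[OF swaps_permutes])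
  then show ?thesis
    unfolding rho_def r0_def r1_def r2_def r3_def
    by (auto intro!: permutes_compose permutes_swap_id)
qed

text \<open>\<open>r0\<close> and \<open>r1\<close> consist of four transpositions,
  \<open>r2\<close> and \<open>r3\<close> of \<open>4 + k\<close>. For
  \<open>n = 2 * k + 12\<close>, evenness of \<open>k\<close> says that 4 divides
  \<open>n\<close>.\<close>

lemma evenperm_rho:
  assumes "even k"
  shows "evenperm (rho k j)"
proof -
  have "permutation (swaps a k)" for a
    using swaps_permutes finite_atLeastLessThan unfolding permutation_permutes by blast
  with assms have "sign (rho k j) = 1"
    unfolding rho_def r0_def r1_def r2_def r3_def
    by (simp add: sign_compose permutation_compose permutation_swap_id sign_swap_id sign_swaps)
  then show ?thesis by (simp add: sign_def split: if_splits)
qed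

text \<open>The parabolic subgroups; the index set \<open>{..<4}\<close> gives the whole
  group.\<close>

abbreviation H :: "nat \<Rightarrow> nat set \<Rightarrow> (nat \<Rightarrow> nat) set" where
  "H k J \<equiv> products (rho k ` J)"

lemma H_incl: "j \<in> J \<Longrightarrow> rho k j \<in> H k J"
  by (rule products_incl) simp

lemma H_mono: "w \<in> H k J \<Longrightarrow> J \<subseteq> K \<Longrightarrow> w \<in> H k K"
  by (rule products_mono[of "rho k ` J"]) auto

lemma H_bij: "w \<in> H k J \<Longrightarrow> bij w"
  by (rule products_bij) (auto simp: rho_rho)

lemma H_alt:
  assumes "even k" "w \<in> H k J"
  shows "w \<in> carrier (alt_group (2 * k + 12))"
  using assms(2)
proof (rule products_induct)
  interpret A: group "alt_group (2 * k + 12)" by (rule alt_group_is_group)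
  show "id \<in> carrier (alt_group (2 * k + 12))"
    using A.one_closed by (simp add: alt_group_one)
  fix s w
  assume "s \<in> rho k ` J" and w: "w \<in> carrier (alt_group (2 * k + 12))"
  then have "s \<in> carrier (alt_group (2 * k + 12))"
    using rho_permutes evenperm_rho[OF assms(1)] by (auto simp: alt_group_carrier)
  with w A.m_closed show "s \<circ> w \<in> carrier (alt_group (2 * k + 12))"
    by (simp add: alt_group_mult)
qed

section \<open>Orders of the products of consecutive generators\<close>

lemma funpow_fix: "f x = x \<Longrightarrow> (f ^^ m) x = x"
  by (induction m) auto

lemma list_cycle_dvd:
  assumes "distinct xs" "xs \<noteq> []" "\<And>i. i < length xs \<Longrightarrow> f (xs ! i) = xs ! (Suc i mod length xs)"
    and "f ^^ m = id"
  shows "length xs dvd m"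
proof -
  have "(f ^^ m) (xs ! 0) = xs ! 0 \<longleftrightarrow> length xs dvd m"
    by (rule funpow_cycle_eq_iff[of "length xs" f "(!) xs", OF assms(3)]) (use assms(1,2) in \<open>auto intro: inj_on_nth\<close>)
  with assms(4) show ?thesis by simp
qed

lemma funpow_12: "(f ^^ 12) x = f (f (f (f (f (f (f (f (f (f (f (f x)))))))))))"
  by (simp add: numeral_eq_Suc)

lemma funpow_3: "(f ^^ 3) x = f (f (f x))"
  by (simp add: numeral_eq_Suc)

lemma funpow_eq_id:
  assumes "f ^^ L = id" "L dvd m"
  shows "f ^^ m = id"
proof -
  obtain q where "m = L * q" using assms(2) by (rule dvdE)
  then show ?thesis using funpow_mult[where m = L and n = q and f = f] assms(1) by simp
qed

lemma r0_r1_order: "(r0 \<circ> r1) ^^ m = id \<longleftrightarrow> 3 dvd m"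
proof
  assume *: "(r0 \<circ> r1) ^^ m = id"
  have "length [1, 2, 3 :: nat] dvd m"
  proof (rule list_cycle_dvd[OF _ _ _ *])
    show "(r0 \<circ> r1) ([1, 2, 3] ! i) = [1, 2, 3] ! (Suc i mod length [1, 2, 3 :: nat])"
      if "i < length [1, 2, 3 :: nat]" for i
    proof -
      from that have "i = 0 \<or> i = 1 \<or> i = 2" by auto
      then show ?thesis by (elim disjE) simp_all
    qed
  qed simp_all
  then show "3 dvd m" by (simp add: numeral_eq_Suc)
next
  assume "3 dvd m"
  have "((r0 \<circ> r1) ^^ 3) x = x" for x
    unfolding funpow_3 by (induction x rule: nat_cases_13) simp_all
  then have "(r0 \<circ> r1) ^^ 3 = id" by (simp add: fun_eq_iff)
  then show "(r0 \<circ> r1) ^^ m = id" using \<open>3 dvd m\<close> by (rule funpow_eq_id)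
qed

text \<open>A cycle of length 4 and one of length 6 force divisibility by 12. Conversely, all
  vertices up to 12 are checked by evaluation, and from 13 on only the involution
  \<open>r2 k\<close> acts.\<close>

lemma r1_r2_order: "(r1 \<circ> r2 k) ^^ m = id \<longleftrightarrow> 12 dvd m"
proof
  assume *: "(r1 \<circ> r2 k) ^^ m = id"
  have "length [2, 3, 9, 4 :: nat] dvd m"
  proof (rule list_cycle_dvd[OF _ _ _ *])
    show "(r1 \<circ> r2 k) ([2, 3, 9, 4] ! i) = [2, 3, 9, 4] ! (Suc i mod length [2, 3, 9, 4 :: nat])"
      if "i < length [2, 3, 9, 4 :: nat]" for i
    proof -
      from that have "i = 0 \<or> i = 1 \<or> i = 2 \<or> i = 3" by auto
      then show ?thesis by (elim disjE) simp_all
    qed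
  qed simp_all
  then have "4 dvd m" by (simp add: numeral_eq_Suc)
  moreover have "length [5, 12, 10, 8, 7, 11 :: nat] dvd m"
  proof (rule list_cycle_dvd[OF _ _ _ *])
    show "(r1 \<circ> r2 k) ([5, 12, 10, 8, 7, 11] ! i)
        = [5, 12, 10, 8, 7, 11] ! (Suc i mod length [5, 12, 10, 8, 7, 11 :: nat])"
      if "i < length [5, 12, 10, 8, 7, 11 :: nat]" for i
    proof -
      from that have "i = 0 \<or> i = 1 \<or> i = 2 \<or> i = 3 \<or> i = 4 \<or> i = 5" by auto
      then show ?thesis by (elim disjE) simp_all
    qed
  qed simp_all
  then have "6 dvd m" by (simp add: numeral_eq_Suc)
  ultimately show "12 dvd m" by presburger
next
  assume "12 dvd m"
  have "((r1 \<circ> r2 k) ^^ 12) x = x" for x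
    unfolding funpow_12 by (induction x rule: nat_cases_13) simp_all
  then have "(r1 \<circ> r2 k) ^^ 12 = id" by (simp add: fun_eq_iff)
  then show "(r1 \<circ> r2 k) ^^ m = id" using \<open>12 dvd m\<close> by (rule funpow_eq_id)
qed

text \<open>\<open>\<rho>\<^sub>2\<rho>\<^sub>3\<close> runs up the path \<open>\<mu>, i, b, f\<^sub>1, \<dots>, f\<^sub>t\<close> along every second vertex and back
  along the others; \<open>long_cycle\<close> lists the vertices in that order.\<close>

definition long_cycle :: "nat \<Rightarrow> nat \<Rightarrow> nat" where
  "long_cycle k i = (if i = 0 then 3 else if i = 1 then 4 else if i \<le> k + 2 then 8 + 2 * i
     else if i = 2 * k + 3 then 5 else 4 * k + 17 - 2 * i)"

lemma long_cycle_step: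
  assumes "1 \<le> k" "i < 2 * k + 4"
  shows "(r2 k \<circ> r3 k) (long_cycle k i) = long_cycle k (Suc i mod (2 * k + 4))"
proof -
  consider "i = 0" | "i = 1" | "2 \<le> i" "i < k + 2" | "i = k + 2"
    | "k + 2 < i" "i < 2 * k + 2" | "k + 2 < i" "i = 2 * k + 2" | "i = 2 * k + 3"
    using assms by linarith
  then show ?thesis
  proof cases
    case 1
    then show ?thesis by (simp add: long_cycle_def)
  next
    case 2
    then show ?thesis using assms by (simp add: long_cycle_def)
  next
    case 3
    then have "long_cycle k i = 8 + 2 * i" "long_cycle k (Suc i mod (2 * k + 4)) = 10 + 2 * i"
      by (auto simp: long_cycle_def)
    moreover have "r3 k (8 + 2 * i) = 9 + 2 * i" using 3 by (simp add: r3_tail swaps_def)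
    moreover have "r2 k (9 + 2 * i) = 10 + 2 * i" using 3 by (simp add: r2_tail swaps_def)
    ultimately show ?thesis by simp
  next
    \<comment> \<open>The turning point: the last vertex of the path lies on no edge with label
      3.\<close>
    case 4
    then have "long_cycle k i = 2 * k + 12" "long_cycle k (Suc i mod (2 * k + 4)) = 2 * k + 11"
      using assms by (auto simp: long_cycle_def)
    moreover have "r3 k (2 * k + 12) = 2 * k + 12" by (simp add: r3_tail swaps_def)
    moreover have "r2 k (2 * k + 12) = 2 * k + 11" using assms by (simp add: r2_tail swaps_def)
    ultimately show ?thesis by simp
  next
    case 5
    \<comment> \<open>Counting from the far end gives the returning half the form
      \<open>15 + 2 * j\<close>, free of truncated subtraction.\<close>
    define j where "j = 2 * k + 1 - i"
    have i: "i = 2 * k + 1 - j" and j: "j < k" using 5 by (auto simp: j_def)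
    have "long_cycle k i = 15 + 2 * j" "long_cycle k (Suc i mod (2 * k + 4)) = 13 + 2 * j"
      using 5 j by (auto simp: long_cycle_def i)
    moreover have "r3 k (15 + 2 * j) = 14 + 2 * j"
      using j 5 by (simp add: r3_tail swaps_def j_def)
    moreover have "r2 k (14 + 2 * j) = 13 + 2 * j" using j by (simp add: r2_tail swaps_def)
    ultimately show ?thesis by simp
  next
    case 6
    then have "long_cycle k i = 13" "long_cycle k (Suc i mod (2 * k + 4)) = 5"
      by (auto simp: long_cycle_def)
    moreover have "r3 k 13 = 12" using assms by (simp add: r3_tail swaps_def)
    ultimately show ?thesis by simp
  next
    case 7
    then have "Suc i = 2 * k + 4" by simp
    then have "Suc i mod (2 * k + 4) = 0" by (simp only: mod_self)
    with 7 show ?thesis by (simp add: long_cycle_def)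
  qed
qed

lemma inj_on_long_cycle: "inj_on (long_cycle k) {..<2 * k + 4}"
proof (rule inj_onI)
  fix i j
  assume "i \<in> {..<2 * k + 4}" "j \<in> {..<2 * k + 4}" "long_cycle k i = long_cycle k j"
  then show "i = j" by (auto simp: long_cycle_def split: if_splits; presburger)
qed

text \<open>Even vertices of the path are met on the way up and odd ones on the way back; the
  witnesses invert the two linear formulas.\<close>

lemma long_cycle_surj:
  assumes "1 \<le> k" "x \<in> {3, 4, 5} \<or> 12 \<le> x \<and> x \<le> 2 * k + 12"
  shows "\<exists>i < 2 * k + 4. long_cycle k i = x"
proof -
  consider "x = 3" | "x = 4" | "x = 5" | "12 \<le> x" "x \<le> 2 * k + 12" "even x"
    | "12 \<le> x" "x \<le> 2 * k + 12" "odd x"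
    using assms(2) by auto
  then show ?thesis
  proof cases
    case 1
    then show ?thesis by (intro exI[of _ 0]) (simp add: long_cycle_def)
  next
    case 2
    then show ?thesis by (intro exI[of _ 1]) (simp add: long_cycle_def)
  next
    case 3
    then show ?thesis by (intro exI[of _ "2 * k + 3"]) (use assms(1) in \<open>simp add: long_cycle_def\<close>)
  next
    case 4
    then obtain y where "x = 2 * y" by (elim evenE)
    with 4 show ?thesis by (intro exI[of _ "y - 4"]) (auto simp: long_cycle_def)
  next
    case 5
    then obtain y where "x = 2 * y + 1" by (elim oddE)
    with 5 show ?thesis by (intro exI[of _ "2 * k + 8 - y"]) (auto simp: long_cycle_def)
  qed
qed

text \<open>The other nontrivial cycle of \<open>r2 k \<circ> r3 k\<close>, on the vertices h, e, a,
  g, d, c.\<close>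

abbreviation short_cycle :: "nat list" where
  "short_cycle \<equiv> [9, 11, 7, 6, 8, 10]"

lemma short_cycle_step:
  assumes "i < 6"
  shows "(r2 k \<circ> r3 k) (short_cycle ! i) = short_cycle ! (Suc i mod 6)"
proof -
  from assms have "i = 0 \<or> i = 1 \<or> i = 2 \<or> i = 3 \<or> i = 4 \<or> i = 5" by auto
  then show ?thesis by (elim disjE) simp_all
qed

text \<open>The nontrivial cycles have lengths \<open>2 * k + 4\<close>, which is
  \<open>n - 8\<close>, and 6; all other numbers are fixed.\<close>

lemma r2_r3_order:
  assumes "1 \<le> k"
  shows "(r2 k \<circ> r3 k) ^^ m = id \<longleftrightarrow> 2 * k + 4 dvd m \<and> 6 dvd m"
proof
  assume *: "(r2 k \<circ> r3 k) ^^ m = id"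
  have "length short_cycle dvd m"
    by (rule list_cycle_dvd[OF _ _ _ *]) (use short_cycle_step in simp_all)
  then have "6 dvd m" by (simp add: numeral_eq_Suc)
  moreover have "2 * k + 4 dvd m"
    using funpow_cycle_eq_iff[of "2 * k + 4" "r2 k \<circ> r3 k" "long_cycle k" m,
        OF long_cycle_step[OF assms] inj_on_long_cycle] * by simp
  ultimately show "2 * k + 4 dvd m \<and> 6 dvd m" by blast
next
  assume dvd: "2 * k + 4 dvd m \<and> 6 dvd m"
  show "(r2 k \<circ> r3 k) ^^ m = id"
  proof
    fix x :: nat
    have "x < 3 \<or> x = 3 \<or> x = 4 \<or> x = 5 \<or> x = 6 \<or> x = 7 \<or> x = 8 \<or> x = 9 \<or> x = 10 \<or> x = 11 \<or> 12 \<le> x"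
      by presburger
    then consider "x < 3 \<or> 2 * k + 12 < x" | "x \<in> set short_cycle"
      | "x \<in> {3, 4, 5} \<or> 12 \<le> x \<and> x \<le> 2 * k + 12"
      by fastforce
    then have "((r2 k \<circ> r3 k) ^^ m) x = x"
    proof cases
      case 1
      then have "x = 0 \<or> x = 1 \<or> x = 2 \<or> 2 * k + 12 < x" by presburger
      then have "r3 k x = x" "r2 k x = x"
        by (auto simp: r2_tail r3_tail swaps_def)
      then show ?thesis by (intro funpow_fix) simp
    next
      case 2
      have "length short_cycle = 6" by (simp add: numeral_eq_Suc)
      with 2 obtain i where i: "i < 6" "x = short_cycle ! i"
        unfolding in_set_conv_nth by metis
      have "(i + m) mod 6 = i" using dvd i(1) by (metis add.right_neutral dvd_imp_mod_0 mod_add_right_eq mod_less)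
      with funpow_cycle[of 6 "r2 k \<circ> r3 k" "(!) short_cycle", OF short_cycle_step i(1), of m] i(2)
      show ?thesis by simp
    next
      case 3
      then obtain i where i: "i < 2 * k + 4" "x = long_cycle k i"
        using long_cycle_surj[OF assms] by metis
      have "(i + m) mod (2 * k + 4) = i"
        using dvd i(1) by (metis add.right_neutral dvd_imp_mod_0 mod_add_right_eq mod_less)
      with funpow_cycle[of "2 * k + 4" "r2 k \<circ> r3 k" "long_cycle k", OF long_cycle_step[OF assms] i(1), of m] i(2)
      show ?thesis by simp
    qed
    then show "((r2 k \<circ> r3 k) ^^ m) x = id x" by simp
  qed
qed

section \<open>The alternating group\<close>

text \<open>The form to which \<open>cycle_of_list [a, b, c]\<close> unfolds; it sends
  \<open>a\<close> to \<open>b\<close>, \<open>b\<close> to \<open>c\<close> and \<open>c\<close> to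
  \<open>a\<close>.\<close>

definition three_cycle :: "'a \<Rightarrow> 'a \<Rightarrow> 'a \<Rightarrow> 'a \<Rightarrow> 'a" where
  "three_cycle a b c = transpose a b \<circ> transpose b c"

lemma three_cycle_apply:
  "distinct [a, b, c] \<Longrightarrow>
    three_cycle a b c x = (if x = a then b else if x = b then c else if x = c then a else x)"
  by (auto simp: three_cycle_def transpose_def)

lemma three_cycle_conj:
  assumes "s \<circ> s = id" "distinct [a, b, c]"
  shows "s \<circ> (three_cycle a b c \<circ> s) = three_cycle (s a) (s b) (s c)"
proof
  fix x
  have ss: "s (s y) = y" for y using assms(1) by (simp add: fun_eq_iff)
  then have eq: "s y = z \<longleftrightarrow> y = s z" for y z by metis
  have "distinct [s a, s b, s c]" using assms(2) ss by (auto simp: eq)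
  then show "(s \<circ> (three_cycle a b c \<circ> s)) x = three_cycle (s a) (s b) (s c) x"
    using assms(2) by (simp add: three_cycle_apply ss eq)
qed

lemma three_cycle_rotate: "distinct [a, b, c] \<Longrightarrow> three_cycle a b c = three_cycle b c a"
  by (auto simp: fun_eq_iff three_cycle_apply)

lemma three_cycle_square: "distinct [a, b, c] \<Longrightarrow> three_cycle a b c \<circ> three_cycle a b c = three_cycle a c b"
  by (auto simp: fun_eq_iff three_cycle_apply)

text \<open>Two 3-cycles sharing the points \<open>c\<close> and \<open>d\<close> yield one through
  \<open>a\<close> and \<open>b\<close>. This is how known 3-cycles spread.\<close>

lemma three_cycle_merge:
  "distinct [a, b, c, d] \<Longrightarrow>
    three_cycle b c d \<circ> (three_cycle a c d \<circ> three_cycle a c d) = three_cycle a b c"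
  by (auto simp: fun_eq_iff three_cycle_apply)

text \<open>The two conjugates of \<open>\<rho>\<^sub>1\<close> below share the transposition \<open>(6 9)\<close> and otherwise meet only in the
  vertex 2, so their product is a 3-cycle times an involution disjoint from it, and its square is a
  3-cycle.\<close>

lemma r1_conj:
  assumes "1 \<le> k"
  shows "r3 k (r2 k (r1 (r2 k (r3 k x))))
    = (transpose 2 5 \<circ> transpose 3 10 \<circ> transpose 6 9 \<circ> transpose 8 13) x"
proof -
  have [simp]: "r3 k 12 = 13" "r3 k 13 = 12" using assms by (auto simp: r3_tail swaps_def)
  show ?thesis
  proof (induction x rule: nat_cases_13)
    case (14 y)
    show ?case
    proof (cases "y = 13")
      case False
      with 14 have "14 \<le> y" by simp
      then have "13 \<le> r3 k y" by (auto simp: r3_tail swaps_def)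
      with \<open>14 \<le> y\<close> show ?thesis by (simp add: transpose_def)
    qed (simp add: transpose_def)
  qed (simp_all add: transpose_def)
qed

lemma r1_conj':
  assumes "1 \<le> k"
  shows "r2 k (r3 k (r2 k (r1 (r2 k (r3 k (r2 k x))))))
    = (transpose 2 12 \<circ> transpose 4 11 \<circ> transpose 6 9 \<circ> transpose 7 14) x"
proof -
  have [simp]: "r2 k 13 = 14" "r2 k 14 = 13" using assms by (auto simp: r2_tail swaps_def)
  show ?thesis
    unfolding r1_conj[OF assms]
  proof (induction x rule: nat_cases_13)
    case (14 y)
    then consider "y = 13" | "y = 14" | "15 \<le> y" by linarith
    then show ?case
    proof cases
      case 3
      then have "14 \<le> r2 k y" by (auto simp: r2_tail swaps_def)
      with 3 show ?thesis by (simp add: transpose_def)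
    qed (simp_all add: transpose_def)
  qed (simp_all add: transpose_def)
qed

section \<open>All 3-cycles lie in the group\<close>

context
  fixes k :: nat
  assumes k: "1 \<le> k"
begin

text \<open>The implication makes degenerate triples true, so that \<open>inG_all\<close> can range
  over arbitrary triples.\<close>

abbreviation "inG a b c \<equiv> distinct [a, b, c] \<longrightarrow> three_cycle a b c \<in> H k {..<4}"

lemma three_cycle_2_5_12: "three_cycle 2 5 12 \<in> H k {..<4}"
proof -
  define u where "u = r3 k \<circ> (r2 k \<circ> (r1 \<circ> (r2 k \<circ> r3 k)))"
  define v where "v = r2 k \<circ> (u \<circ> r2 k)"
  have r: "r1 \<in> H k {..<4}" "r2 k \<in> H k {..<4}" "r3 k \<in> H k {..<4}"
    using H_incl[of 1 "{..<4}" k] H_incl[of 2 "{..<4}" k] H_incl[of 3 "{..<4}" k] by simp_all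
  have "u \<in> H k {..<4}" unfolding u_def by (intro products_comp r)
  moreover from this have "v \<in> H k {..<4}" unfolding v_def by (intro products_comp r)
  ultimately have "(u \<circ> v) \<circ> (u \<circ> v) \<in> H k {..<4}" by (intro products_comp)
  \<comment> \<open>The common (6 9) cancels: \<open>u \<circ> v\<close> is (2 12 5)(3 10)(8 13)(4
    11)(7 14), and squaring leaves (2 5 12).\<close>
  moreover have "(u \<circ> v) \<circ> (u \<circ> v) = three_cycle 2 5 12"
  proof
    fix x
    have u: "u = transpose 2 5 \<circ> transpose 3 10 \<circ> transpose 6 9 \<circ> transpose 8 13"
      by (rule ext) (simp add: u_def r1_conj[OF k])
    have v: "v = transpose 2 12 \<circ> transpose 4 11 \<circ> transpose 6 9 \<circ> transpose 7 14"
      by (rule ext) (simp add: u_def v_def r1_conj'[OF k])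
    show "((u \<circ> v) \<circ> (u \<circ> v)) x = three_cycle 2 5 12 x"
      unfolding u v comp_apply
    proof (induction x rule: nat_cases_13)
      case (14 y)
      then consider "y = 13" | "y = 14" | "15 \<le> y" by linarith
      then show ?case using 14 by cases (simp_all add: transpose_def three_cycle_apply)
    qed (simp_all add: transpose_def three_cycle_apply)
  qed
  ultimately show ?thesis by simp
qed

lemma inG_rotate: "inG a b c \<Longrightarrow> inG b c a"
  using three_cycle_rotate[of a b c] by auto

lemma inG_swap: "inG a b c \<Longrightarrow> inG a c b"
  using three_cycle_square[of a b c] products_comp[of "three_cycle a b c" _ "three_cycle a b c"]
  by auto

lemma inG_merge: "inG a c d \<Longrightarrow> inG b c d \<Longrightarrow> distinct [a, b, c, d] \<Longrightarrow> inG a b c"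
  using three_cycle_merge[of a b c d]
    products_comp[of "three_cycle a c d" _ "three_cycle a c d"]
    products_comp[of "three_cycle b c d" _ "three_cycle a c d \<circ> three_cycle a c d"]
  by auto

lemma inG_conj:
  assumes "inG a b c" "distinct [a, b, c]" "j < 4"
  shows "inG (rho k j a) (rho k j b) (rho k j c)"
proof -
  have "rho k j \<in> H k {..<4}" using assms(3) by (intro H_incl) simp
  then have "rho k j \<circ> (three_cycle a b c \<circ> rho k j) \<in> H k {..<4}"
    using assms(1,2) by (intro products_comp) auto
  then show ?thesis
    using three_cycle_conj[OF rho_rho assms(2), of k j] by simp
qed

lemma inG_1_2:
  assumes "3 \<le> z" "z \<le> 2 * k + 12"
  shows "inG 1 2 z"
proof -
  have r2: "inG 1 2 (r2 k z)" if "inG 1 2 z" "2 < z" for z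
    using inG_conj[OF that(1), of 2] that(2) by simp
  have r3: "inG 1 2 (r3 k z)" if "inG 1 2 z" "2 < z" for z
    using inG_conj[OF that(1), of 3] that(2) by simp
  \<comment> \<open>\<open>r0\<close> fixes 5 and 12 and sends 2 to 1, so the two 3-cycles share two
    points and merge.\<close>
  have "inG 2 5 12" using three_cycle_2_5_12 by simp
  moreover from inG_conj[OF this, of 0] have "inG 1 5 12" by simp
  ultimately have 5: "inG 1 2 5" using inG_merge[of 1 5 12 2] by simp
  then have 4: "inG 1 2 4" using r3[of 5] by simp
  then have 3: "inG 1 2 3" using r2[of 4] by simp
  have 12: "inG 1 2 12" using r2[of 5] 5 by simp
  have tail: "inG 1 2 x" if "12 \<le> x" "x \<le> 2 * k + 12" for x
    using that
  proof (induction x rule: dec_induct)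
    case (step x)
    then have IH: "inG 1 2 x" "2 < x" by simp_all
    show ?case
    \<comment> \<open>The path edge from \<open>x\<close> to \<open>Suc x\<close> has label 3 for
      even \<open>x\<close> and label 2 for odd \<open>x\<close>.\<close>
    proof (cases "even x")
      case True
      with step have "r3 k x = Suc x" by (simp add: r3_tail swaps_def)
      with r3[OF IH] show ?thesis by simp
    next
      case False
      with step have "13 \<le> x" by presburger
      with step False have "r2 k x = Suc x" by (simp add: r2_tail swaps_def)
      with r2[OF IH] show ?thesis by simp
    qed
  qed (rule 12)
  \<comment> \<open>Passage to the second orbit of the group generated by \<open>r2\<close> and
    \<open>r3\<close>: \<open>r1\<close> sends (1 2 4) to (1 3 9), and 9 lies in that orbit.\<close>
  from inG_conj[OF 4, of 1] have "inG 1 3 9" by simp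
  then have "inG 9 1 3" using inG_rotate by blast
  moreover have "inG 2 1 3" using 3 inG_rotate inG_swap by blast
  ultimately have "inG 9 2 1" using inG_merge[of 9 1 3 2] by simp
  then have 9: "inG 1 2 9" using inG_rotate inG_swap by blast
  then have 10: "inG 1 2 10" using r3[of 9] by simp
  then have 11: "inG 1 2 11" using r2[of 10] by simp
  then have 8: "inG 1 2 8" using r3[of 11] by simp
  then have 7: "inG 1 2 7" using r2[of 8] by simp
  then have 6: "inG 1 2 6" using r3[of 7] by simp
  show ?thesis
  proof (cases "12 \<le> z")
    case False
    with assms(1) have "z = 3 \<or> z = 4 \<or> z = 5 \<or> z = 6 \<or> z = 7 \<or> z = 8 \<or> z = 9 \<or> z = 10 \<or> z = 11"
      by presburger
    then show ?thesis using 3 4 5 6 7 8 9 10 11 by (elim disjE) (simp_all only:)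
  qed (rule tail[OF _ assms(2)])
qed

text \<open>The two fixed points are freed in turn: merging over the pair 1, 2 replaces 2 by any
  vertex, and merging over \<open>a\<close>, 1 then removes 1.\<close>

lemma inG_all:
  assumes "{a, b, c} \<subseteq> {1..2 * k + 12}"
  shows "inG a b c"
proof -
  have two: "inG 1 2 z" if "z \<in> {1..2 * k + 12}" for z
  proof (cases "z = 1 \<or> z = 2")
    case False
    with that show ?thesis by (intro inG_1_2) auto
  qed auto
  have one: "inG 1 x y" if "x \<in> {1..2 * k + 12}" "y \<in> {1..2 * k + 12}" for x y
  proof (cases "distinct [1, 2, x, y]")
    case True
    have "inG x 1 2" "inG y 1 2" using two[OF that(1)] two[OF that(2)] inG_rotate by blast+
    then have "inG x y 1" using True by (intro inG_merge[of x 1 2 y]) auto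
    then show ?thesis using inG_rotate by blast
  next
    case False
    then show ?thesis using two[OF that(1)] two[OF that(2)] inG_swap by auto
  qed
  show ?thesis
  proof (cases "distinct [1, a, b, c]")
    case True
    have "inG b a 1" "inG c a 1" using one[of b a] one[of c a] assms inG_rotate by blast+
    then have "inG b c a" using True by (intro inG_merge[of b a 1 c]) auto
    then show ?thesis using inG_rotate by blast
  next
    case False
    then consider "a = 1" | "b = 1" | "c = 1" | "\<not> distinct [a, b, c]" by auto
    then show ?thesis
    proof cases
      case 1
      then show ?thesis using one assms by auto
    next
      case 2
      then have "inG b c a" using one assms by auto
      then show ?thesis using inG_rotate by blast
    next
      case 3
      then have "inG c a b" using one assms by auto
      then show ?thesis using inG_rotate by blast
    qed blast
  qed
qed

end

text \<open>Parity gives one inclusion; generation of the alternating group by 3-cycles gives the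
  other.\<close>

lemma H_eq_alt:
  assumes "1 \<le> k" "even k"
  shows "H k {..<4} = carrier (alt_group (2 * k + 12))"
proof
  show "H k {..<4} \<subseteq> carrier (alt_group (2 * k + 12))"
    using H_alt[OF assms(2)] by blast
  interpret A: group "alt_group (2 * k + 12)" by (rule alt_group_is_group)
  have cyc: "h \<in> H k {..<4} \<and> inv\<^bsub>alt_group (2 * k + 12)\<^esub> h \<in> H k {..<4}"
    if h3: "h \<in> three_cycles (2 * k + 12)" for h
  proof -
    obtain cs where cs: "h = cycle_of_list cs" "cycle cs" "length cs = 3" "set cs \<subseteq> {1..2 * k + 12}"
      using h3 by blast
    obtain a b c where abc: "cs = [a, b, c]" using stupid_lemma[OF cs(3)] by blast
    have d: "distinct [a, b, c]" using cs abc by simp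
    have h: "h = three_cycle a b c" using cs(1) abc by (simp add: three_cycle_def)
    have hG: "h \<in> H k {..<4}"
      using inG_all[OF assms(1), of a b c] cs(4) abc d h by simp
    then have hh: "h \<circ> h \<in> H k {..<4}" by (intro products_comp)
    have "(h \<circ> h) \<circ> h = id"
      unfolding h three_cycle_square[OF d] using d by (auto simp: fun_eq_iff three_cycle_apply)
    then have "inv\<^bsub>alt_group (2 * k + 12)\<^esub> h = h \<circ> h"
      using H_alt[OF assms(2)] hG hh
      by (intro A.inv_equality) (simp_all only: alt_group_mult alt_group_one)
    with hG hh show ?thesis by simp
  qed
  show "carrier (alt_group (2 * k + 12)) \<subseteq> H k {..<4}"
    unfolding alt_group_carrier_as_three_cycles
  proof
    fix x assume "x \<in> generate (alt_group (2 * k + 12)) (three_cycles (2 * k + 12))"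
    then show "x \<in> H k {..<4}"
    proof (rule generate.induct)
      show "\<one>\<^bsub>alt_group (2 * k + 12)\<^esub> \<in> H k {..<4}"
        unfolding alt_group_one by (rule products_id)
      show "h \<otimes>\<^bsub>alt_group (2 * k + 12)\<^esub> h' \<in> H k {..<4}"
        if "h \<in> H k {..<4}" "h' \<in> H k {..<4}" for h h'
        unfolding alt_group_mult using that by (rule products_comp)
    qed (use cyc in blast)+
  qed
qed

section \<open>The intersection property\<close>

lemma rho_commute: "rho k i \<circ> rho k j = rho k j \<circ> rho k i" if "i + 2 \<le> j"
proof -
  have "i = 0 \<and> j = 2 \<or> i = 0 \<and> j = 3 \<or> i = 1 \<and> j = 3 \<or> 4 \<le> j"
    using that by presburger
  then show ?thesis
    by (elim disjE) (auto simp: fun_eq_iff r0_r2 r0_r3 r1_r3 rho_def)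
qed

text \<open>An index without neighbours in \<open>K\<close> gives a generator commuting with the
  rest, which can be pulled to the front.\<close>

lemma H_split:
  assumes "w \<in> H k K" "\<And>i. i \<in> K \<Longrightarrow> i \<noteq> j \<Longrightarrow> i + 2 \<le> j \<or> j + 2 \<le> i"
  shows "w \<in> H k (K - {j}) \<or> (\<exists>y \<in> H k (K - {j}). w = rho k j \<circ> y)"
proof (rule products_insert_commute)
  show "w \<in> products (insert (rho k j) (rho k ` (K - {j})))"
    using assms(1) by (rule products_mono[rotated]) auto
  show "rho k j \<circ> rho k j = id" by (rule rho_rho)
  show "t \<circ> rho k j = rho k j \<circ> t" if t: "t \<in> rho k ` (K - {j})" for t
  proof -
    obtain i where i: "i \<in> K" "i \<noteq> j" "t = rho k i" using t by blast
    show ?thesis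
      using assms(2)[OF i(1,2)] rho_commute[of i j k] rho_commute[of j i k] unfolding i(3) by metis
  qed
qed

lemma H_fix_1: "w \<in> H k J \<Longrightarrow> 0 \<notin> J \<Longrightarrow> w 1 = 1"
  by (rule products_fix) (auto simp: rho_def)

text \<open>\<open>r0\<close> and \<open>r1\<close> satisfy the braid relation, so the six listed
  words are closed under left multiplication by both.\<close>

lemma H_01:
  assumes "w \<in> H k {0, 1}"
  shows "w \<in> {id, r0, r1, r0 \<circ> r1, r1 \<circ> r0, r0 \<circ> (r1 \<circ> r0)}" (is "_ \<in> ?D")
  using assms
proof (rule products_induct)
  show "id \<in> ?D" by blast
  fix s w
  assume s: "s \<in> rho k ` {0, 1}" and w: "w \<in> ?D"
  have 00: "r0 \<circ> r0 = id" "r0 \<circ> (r0 \<circ> y) = y" for y :: "nat \<Rightarrow> nat"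
    by (simp_all add: fun_eq_iff)
  have 11: "r1 \<circ> r1 = id" "r1 \<circ> (r1 \<circ> y) = y" for y :: "nat \<Rightarrow> nat"
    by (simp_all add: fun_eq_iff)
  have "r1 (r0 (r1 x)) = r0 (r1 (r0 x))" for x
    by (induction x rule: nat_cases_13) simp_all
  then have "r1 \<circ> (r0 \<circ> r1) = r0 \<circ> (r1 \<circ> r0)" "r1 \<circ> (r0 \<circ> (r1 \<circ> r0)) = r0 \<circ> r1"
    by (simp_all add: fun_eq_iff)
  moreover have "s = r0 \<or> s = r1" using s by auto
  ultimately show "s \<circ> w \<in> ?D"
    using w 00 11 by (elim insertE disjE emptyE; simp only:) (simp_all add: 00 11)
qed

text \<open>The representatives send the vertex 1 to 1, 2, 3, 4, 9, 6 respectively.\<close>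

lemma H_012_coset:
  assumes "w \<in> H k {0, 1, 2}"
  shows "\<exists>t \<in> {id, r0, r1 \<circ> r0, r2 k \<circ> (r1 \<circ> r0), r1 \<circ> (r2 k \<circ> (r1 \<circ> r0)),
    r0 \<circ> (r1 \<circ> (r2 k \<circ> (r1 \<circ> r0)))}. \<exists>v \<in> H k {1, 2}. w = t \<circ> v"
proof -
  define t1 where "t1 = r0"
  define t2 where "t2 = r1 \<circ> t1"
  define t3 where "t3 = r2 k \<circ> t2"
  define t4 where "t4 = r1 \<circ> t3"
  define t5 where "t5 = r0 \<circ> t4"
  note t_defs = t1_def t2_def t3_def t4_def t5_def
  \<comment> \<open>\<open>r2 k\<close> fixes the vertices 9 and 6 reached by \<open>t4\<close> and
    \<open>t5\<close>; \<open>x\<close> expresses its conjugates by the inverses of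
    \<open>t4\<close> and of \<open>t5\<close> as a word in \<open>r1\<close> and
    \<open>r2 k\<close>.\<close>
  define x where "x = r2 k \<circ> (r1 \<circ> (r2 k \<circ> (r1 \<circ> (r2 k \<circ> (r1 \<circ> (r2 k \<circ> (r1 \<circ> r2 k)))))))"
  define C where "C w \<longleftrightarrow> (\<exists>t \<in> {id, t1, t2, t3, t4, t5}. \<exists>v \<in> H k {1, 2}. w = t \<circ> v)" for w
  have gen: "r1 \<in> H k {1, 2}" "r2 k \<in> H k {1, 2}"
    using H_incl[of 1 "{1, 2}" k] H_incl[of 2 "{1, 2}" k] by simp_all
  have x: "x \<in> H k {1, 2}" unfolding x_def by (intro products_comp gen)
  have C: "C (s \<circ> (t \<circ> v))"
    if "s \<circ> t = t' \<circ> (u :: nat \<Rightarrow> nat)" "t' \<in> {id, t1, t2, t3, t4, t5}" "u \<in> H k {1, 2}" "v \<in> H k {1, 2}" for s t t' u v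
  proof -
    have "s \<circ> (t \<circ> v) = t' \<circ> (u \<circ> v)" using that(1) by (metis comp_assoc)
    with that(2) products_comp[OF that(3,4)] show ?thesis unfolding C_def by blast
  qed
  \<comment> \<open>A coset table: each generator times each representative is a representative
    times an element of \<open>H k {1, 2}\<close>.\<close>
  have steps:
    "r0 \<circ> id = t1 \<circ> id" "r1 \<circ> id = id \<circ> r1" "r2 k \<circ> id = id \<circ> r2 k"
    "r0 \<circ> t1 = id \<circ> id" "r1 \<circ> t1 = t2 \<circ> id" "r2 k \<circ> t1 = t1 \<circ> r2 k"
    "r0 \<circ> t2 = t2 \<circ> r1" "r1 \<circ> t2 = t1 \<circ> id" "r2 k \<circ> t2 = t3 \<circ> id"
    "r0 \<circ> t3 = t3 \<circ> r1" "r1 \<circ> t3 = t4 \<circ> id" "r2 k \<circ> t3 = t2 \<circ> id"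
    "r0 \<circ> t4 = t5 \<circ> id" "r1 \<circ> t4 = t3 \<circ> id" "r2 k \<circ> t4 = t4 \<circ> x"
    "r0 \<circ> t5 = t4 \<circ> id" "r1 \<circ> t5 = t5 \<circ> r1" "r2 k \<circ> t5 = t5 \<circ> x"
    unfolding t_defs x_def fun_eq_iff comp_apply id_apply
    by (intro allI, rule nat_cases_13; simp)+
  have "C w" using assms
  proof (rule products_induct)
    show "C id" unfolding C_def using products_id[of "rho k ` {1, 2}"] by (intro bexI[of _ id]) auto
    fix s w
    assume "s \<in> rho k ` {0, 1, 2}" "C w"
    then obtain t v where t: "t \<in> {id, t1, t2, t3, t4, t5}" and v: "v \<in> H k {1, 2}" and w: "w = t \<circ> v"
      unfolding C_def by blast
    have "s = r0 \<or> s = r1 \<or> s = r2 k" using \<open>s \<in> _\<close> by auto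
    then show "C (s \<circ> w)" unfolding w
      using t by (elim disjE insertE emptyE; simp only:) (rule C[OF steps(1) _ _ v] C[OF steps(2) _ _ v]
        C[OF steps(3) _ _ v] C[OF steps(4) _ _ v] C[OF steps(5) _ _ v] C[OF steps(6) _ _ v]
        C[OF steps(7) _ _ v] C[OF steps(8) _ _ v] C[OF steps(9) _ _ v] C[OF steps(10) _ _ v]
        C[OF steps(11) _ _ v] C[OF steps(12) _ _ v] C[OF steps(13) _ _ v] C[OF steps(14) _ _ v]
        C[OF steps(15) _ _ v] C[OF steps(16) _ _ v] C[OF steps(17) _ _ v] C[OF steps(18) _ _ v];
        use x gen products_id in blast)+
  qed
  then show ?thesis unfolding C_def t_defs .
qed

text \<open>\<open>H k {1, 2}\<close> fixes 1, so the image of 1 determines the coset, and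
  \<open>id\<close> is the only representative fixing 1.\<close>

lemma stabilizer_012:
  assumes "w \<in> H k {0, 1, 2}" "w 1 = 1"
  shows "w \<in> H k {1, 2}"
proof -
  obtain t v where t: "t \<in> {id, r0, r1 \<circ> r0, r2 k \<circ> (r1 \<circ> r0), r1 \<circ> (r2 k \<circ> (r1 \<circ> r0)),
    r0 \<circ> (r1 \<circ> (r2 k \<circ> (r1 \<circ> r0)))}" and v: "v \<in> H k {1, 2}" and w: "w = t \<circ> v"
    using H_012_coset[OF assms(1)] by blast
  have "v 1 = 1" using v by (rule H_fix_1) simp
  with assms(2) w have "t 1 = 1" by simp
  with t have "t = id" by auto
  with v w show ?thesis by simp
qed

lemma stabilizer_01:
  assumes "w \<in> H k {0, 1}" "w 1 = 1"
  shows "w \<in> H k {1}"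
proof -
  have "w = id \<or> w = r1" using H_01[OF assms(1)] assms(2) by auto
  then show ?thesis using H_incl[of 1 "{1}" k] products_id by auto
qed

lemma H_012_orbit:
  assumes "w \<in> H k {0, 1, 2}"
  shows "w x \<in> {1, 2, 3, 4, 6, 9} \<longleftrightarrow> x \<in> {1, 2, 3, 4, 6, 9}"
  using assms
proof (rule products_invariant)
  let ?O = "{1, 2, 3, 4, 6, 9 :: nat}"
  have "r0 x \<in> ?O \<longleftrightarrow> x \<in> ?O" "r1 x \<in> ?O \<longleftrightarrow> x \<in> ?O" "r2 k x \<in> ?O \<longleftrightarrow> x \<in> ?O" for x
    by (induction x rule: nat_cases_13; auto dest: r2_tail_ge[of _ 13 k, OF _ order_refl])+
  then show "s x \<in> ?O \<longleftrightarrow> x \<in> ?O" if "s \<in> rho k ` {0, 1, 2}" for s x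
    using that by auto
qed

lemma long_cycle_orbit:
  assumes "i < 2 * k + 4" "long_cycle k i \<in> {1, 2, 3, 4, 6, 9}"
  shows "i = 0 \<or> i = 1"
  using assms by (auto simp: long_cycle_def split: if_splits)

text \<open>The power must preserve the orbit of 1. The long cycle meets that orbit in two adjacent
  positions, 0 and 1, which excludes every shift but 0; the short cycle then excludes all but the
  identity.\<close>

lemma rho_cycle_in_H_012:
  assumes "1 \<le> k" "(r2 k \<circ> r3 k) ^^ m \<in> H k {0, 1, 2}"
  shows "(r2 k \<circ> r3 k) ^^ m = id"
proof -
  let ?f = "r2 k \<circ> r3 k" and ?O = "{1, 2, 3, 4, 6, 9 :: nat}"
  have orbit: "(?f ^^ m) x \<in> ?O" if "x \<in> ?O" for x
    using H_012_orbit[OF assms(2)] that by blast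
  have long: "(?f ^^ m) (long_cycle k i) = long_cycle k ((i + m) mod (2 * k + 4))" if "i < 2 * k + 4" for i
    using funpow_cycle[of "2 * k + 4" ?f "long_cycle k", OF long_cycle_step[OF assms(1)] that] .
  have "long_cycle k (m mod (2 * k + 4)) \<in> ?O"
    using orbit[of 3] long[of 0] by (simp add: long_cycle_def[of k 0])
  then have "m mod (2 * k + 4) = 0 \<or> m mod (2 * k + 4) = 1"
    by (intro long_cycle_orbit[of _ k]) simp_all
  moreover have "m mod (2 * k + 4) \<noteq> 1"
  proof
    assume "m mod (2 * k + 4) = 1"
    then have "(1 + m) mod (2 * k + 4) = 2"
      using mod_add_right_eq[of 1 m "2 * k + 4"] by simp
    then show False
      using orbit[of 4] long[of 1] assms(1) by (simp add: long_cycle_def)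
  qed
  ultimately have dvd: "2 * k + 4 dvd m" by (simp add: mod_eq_0_iff_dvd)
  then have "even m" by (metis dvd_trans dvd_add dvd_triv_left even_numeral)
  have "(?f ^^ m) (short_cycle ! 0) = short_cycle ! ((0 + m) mod 6)"
    by (rule funpow_cycle[of 6 ?f "(!) short_cycle", OF short_cycle_step]) simp_all
  then have short: "short_cycle ! (m mod 6) \<in> ?O" using orbit[of 9] by simp
  \<comment> \<open>The short cycle meets the orbit at 9 and 6, in positions 0 and 3; since
    \<open>m\<close> is even, a shift by 3 is impossible.\<close>
  have "m mod 6 = 0 \<or> m mod 6 = 2 \<or> m mod 6 = 4" using \<open>even m\<close> by presburger
  then have "m mod 6 = 0" using short by auto
  then have "6 dvd m" by (simp add: mod_eq_0_iff_dvd)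
  with dvd r2_r3_order[OF assms(1)] show ?thesis by blast
qed

lemma H_23_012:
  assumes "1 \<le> k" "w \<in> H k {2, 3}" "w \<in> H k {0, 1, 2}"
  shows "w \<in> H k {2}"
proof -
  let ?f = "r2 k \<circ> r3 k"
  have r2: "r2 k \<circ> r2 k = id" "r3 k \<circ> r3 k = id" by (auto simp: fun_eq_iff)
  \<comment> \<open>Any positive common multiple of the two cycle lengths serves as the
    exponent.\<close>
  have "?f ^^ ((2 * k + 4) * 6) = id" by (simp only: r2_r3_order[OF assms(1)] dvd_triv_left dvd_triv_right simp_thms)
  moreover have "w \<in> products {r2 k, r3 k}" using assms(2) by simp
  ultimately obtain m where m: "w = ?f ^^ m \<or> w = ?f ^^ m \<circ> r2 k"
    using products_two_involutions[of w "r2 k" "r3 k" "(2 * k + 4) * 6"] r2 by auto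
  have gen: "r2 k \<in> H k {0, 1, 2}" "r2 k \<in> H k {2}"
    using H_incl[of 2 "{0, 1, 2}" k] H_incl[of 2 "{2}" k] by simp_all
  from m show ?thesis
  proof
    assume "w = ?f ^^ m"
    with assms(3) have "w = id" using rho_cycle_in_H_012[OF assms(1)] by simp
    then show ?thesis using products_id by simp
  next
    assume w: "w = ?f ^^ m \<circ> r2 k"
    then have "w \<circ> r2 k = ?f ^^ m" by (simp add: comp_assoc r2)
    with products_comp[OF assms(3) gen(1)] have "?f ^^ m = id"
      using rho_cycle_in_H_012[OF assms(1)] by simp
    with w gen(2) show ?thesis by simp
  qed
qed

text \<open>Without index 1, \<open>r0\<close> splits off, and it would move 1. With 1 and 3
  present, 2 is absent because \<open>K\<close> is proper, so \<open>r3\<close> splits off instead.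
  Otherwise the stabilizer lemmas apply.\<close>

lemma H_drop_0:
  assumes "w \<in> H k K" "w 1 = 1" "K \<subset> {0, 1, 2, 3}"
  shows "w \<in> H k (K - {0})"
proof (cases "0 \<in> K")
  case True
  have sub: "K \<subseteq> {0, 1, 2, 3}" and ne: "K \<noteq> {0, 1, 2, 3}" using assms(3) by auto
  consider "1 \<notin> K" | "1 \<in> K" "3 \<in> K" | "1 \<in> K" "3 \<notin> K" by blast
  then show ?thesis
  proof cases
    case 1
    have "w \<in> H k (K - {0}) \<or> (\<exists>y \<in> H k (K - {0}). w = rho k 0 \<circ> y)"
      using assms(1) by (rule H_split) (use sub 1 in auto)
    moreover have "w \<noteq> rho k 0 \<circ> y" if "y \<in> H k (K - {0})" for y
      using H_fix_1[OF that] assms(2) by auto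
    ultimately show ?thesis by blast
  next
    case 2
    then have "2 \<notin> K" using True ne sub by auto
    then have K: "K = {0, 1, 3}" using 2 True sub by auto
    have "w \<in> H k (K - {3}) \<or> (\<exists>y \<in> H k (K - {3}). w = rho k 3 \<circ> y)"
      using assms(1) by (rule H_split) (auto simp: K)
    moreover have "K - {3} = {0, 1}" using K by auto
    ultimately obtain y where y: "y \<in> H k {0, 1}" "w = y \<or> w = r3 k \<circ> y" by auto
    have "y 1 = w 1 \<or> y 1 = r3 k (w 1)" using y(2) by auto
    then have "y 1 = 1" using assms(2) by auto
    then have "y \<in> H k (K - {0})"
      using stabilizer_01[OF y(1)] H_mono[of y k "{1}" "K - {0}"] K by auto
    moreover have "r3 k \<in> H k (K - {0})" using H_incl[of 3 "K - {0}" k] K by simp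
    ultimately show ?thesis using y(2) products_comp by blast
  next
    case 3
    then have "K - {0} = (if 2 \<in> K then {1, 2} else {1})"
      "K = (if 2 \<in> K then {0, 1, 2} else {0, 1})"
      using True sub by auto
    with assms(1,2) show ?thesis
      using stabilizer_01[of w k] stabilizer_012[of w k] by (cases "2 \<in> K") auto
  qed
qed (use assms(1) in simp)

text \<open>Without index 2, \<open>r3\<close> splits off. With 2 but not 1, \<open>r0\<close>
  splits off and the dihedral case \<open>H_23_012\<close> remains. With both, 0 is absent because
  \<open>K\<close> is proper, so \<open>w\<close> fixes 1 and \<open>stabilizer_012\<close>
  applies.\<close>

lemma H_drop_3:
  assumes "1 \<le> k" "w \<in> H k K" "w \<in> H k {0, 1, 2}" "K \<subset> {0, 1, 2, 3}"
  shows "w \<in> H k (K - {3})"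
proof (cases "3 \<in> K")
  case True
  have sub: "K \<subseteq> {0, 1, 2, 3}" and ne: "K \<noteq> {0, 1, 2, 3}" using assms(4) by auto
  consider "2 \<notin> K" | "2 \<in> K" "1 \<notin> K" | "2 \<in> K" "1 \<in> K" by blast
  then show ?thesis
  proof cases
    case 1
    have "w \<in> H k (K - {3}) \<or> (\<exists>y \<in> H k (K - {3}). w = rho k 3 \<circ> y)"
      using assms(2) by (rule H_split) (use sub 1 in auto)
    moreover have "w \<noteq> rho k 3 \<circ> y" if y: "y \<in> H k (K - {3})" for y
    proof
      assume w: "w = rho k 3 \<circ> y"
      have inv: "v x \<in> {1, 2, 3, 4, 6, 9} \<longleftrightarrow> x \<in> {1, 2, 3, 4, 6, 9}" if "v \<in> H k {0, 1, 2}" for v x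
        using that by (rule H_012_orbit)
      have "y \<in> H k {0, 1, 2}"
        using y by (rule H_mono) (use sub 1 in auto)
      \<comment> \<open>Vertex 6 lies in the orbit while \<open>r3 k 6 = 7\<close> does not, so
        \<open>w\<close> would carry \<open>x\<close> out of the orbit.\<close>
      moreover obtain x where "y x = 6" using H_bij[OF y] by (metis bij_pointE)
      ultimately show False
        using inv[of y x] inv[OF assms(3), of x] w by simp
    qed
    ultimately show ?thesis by blast
  next
    case 2
    have gen: "r0 \<in> H k {0, 1, 2}" using H_incl[of 0 "{0, 1, 2}" k] by simp
    have y2: "y \<in> H k {2}" if y: "y \<in> H k (K - {0})" "y \<in> H k {0, 1, 2}" for y
    proof -
      have "K - {0} = {2, 3}" using sub 2 True by auto
      with y show ?thesis using H_23_012[OF assms(1)] by simp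
    qed
    have "w \<in> H k (K - {0}) \<or> 0 \<in> K \<and> (\<exists>y \<in> H k (K - {0}). w = rho k 0 \<circ> y)"
    proof (cases "0 \<in> K")
      case True
      have "w \<in> H k (K - {0}) \<or> (\<exists>y \<in> H k (K - {0}). w = rho k 0 \<circ> y)"
        using assms(2) by (rule H_split) (use sub 2 in auto)
      with True show ?thesis by blast
    qed (use assms(2) in simp)
    then show ?thesis
    proof
      assume "w \<in> H k (K - {0})"
      with y2 assms(3) have "w \<in> H k {2}" by blast
      then show ?thesis by (rule H_mono) (use 2 in auto)
    next
      assume *: "0 \<in> K \<and> (\<exists>y \<in> H k (K - {0}). w = rho k 0 \<circ> y)"
      then obtain y where y: "y \<in> H k (K - {0})" "w = r0 \<circ> y" by auto
      then have "y = r0 \<circ> w" by (simp add: fun_eq_iff)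
      with products_comp[OF gen assms(3)] y2 y(1) have "y \<in> H k {2}" by simp
      then have "y \<in> H k (K - {3})" by (rule H_mono) (use 2 in auto)
      moreover have "r0 \<in> H k (K - {3})" using H_incl[of 0 "K - {3}" k] * by simp
      ultimately show ?thesis unfolding y(2) by (intro products_comp)
    qed
  next
    case 3
    then have "0 \<notin> K" using ne sub True by auto
    then have "w 1 = 1" using assms(2) by (intro H_fix_1)
    then have "w \<in> H k {1, 2}" by (rule stabilizer_012[OF assms(3)])
    then show ?thesis by (rule H_mono) (use 3 in auto)
  qed
qed (use assms(2) in simp)

text \<open>Membership on the right makes \<open>w\<close> preserve the pair 1, 2, whose points
  \<open>r3\<close> fixes. Of the six elements of \<open>H k {0, 1}\<close> only \<open>id\<close>
  and \<open>r0\<close> preserve this pair.\<close>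

lemma H_Int_013_023:
  assumes "w \<in> H k {0, 1, 3}" "w \<in> H k {0, 2, 3}"
  shows "w \<in> H k {0, 3}"
proof -
  have "w \<in> H k ({0, 1, 3} - {3}) \<or> (\<exists>y \<in> H k ({0, 1, 3} - {3}). w = rho k 3 \<circ> y)"
    using assms(1) by (rule H_split) auto
  moreover have "{0, 1, 3} - {3} = {0, 1 :: nat}" by auto
  ultimately obtain y where y: "y \<in> H k {0, 1}" "w = y \<or> w = r3 k \<circ> y" by auto
  have "w \<in> H k ({0, 2, 3} - {0}) \<or> (\<exists>z \<in> H k ({0, 2, 3} - {0}). w = rho k 0 \<circ> z)"
    using assms(2) by (rule H_split) auto
  moreover have "{0, 2, 3} - {0} = {2, 3 :: nat}" by auto
  ultimately obtain z where z: "z \<in> H k {2, 3}" "w = z \<or> w = r0 \<circ> z" by auto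
  have "z 1 = 1" "z 2 = 2"
    using z(1) by (auto elim!: products_fix)
  then have w: "w 1 = 1 \<and> w 2 = 2 \<or> w 1 = 2 \<and> w 2 = 1" using z(2) by auto
  moreover have "w 1 = y 1 \<and> w 2 = y 2"
  proof -
    have "y 1 = r3 k (w 1) \<and> y 2 = r3 k (w 2) \<or> y = w" using y(2) by auto
    with w show ?thesis by auto
  qed
  ultimately have "y = id \<or> y = r0" using H_01[OF y(1)] by auto
  moreover have "id \<in> H k {0, 3}" "r0 \<in> H k {0, 3}" "r3 k \<in> H k {0, 3}"
    using products_id H_incl[of 0 "{0, 3}" k] H_incl[of 3 "{0, 3}" k] by auto
  ultimately show ?thesis using y(2) products_comp by blast
qed

text \<open>The previous lemma leaves the indices 0 and 3, and each of them missing from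
  \<open>A\<close> is then dropped.\<close>

lemma H_Int_core:
  assumes "1 \<le> k" "w \<in> H k A" "w \<in> H k B" "A \<subseteq> {0, 1, 3}" "B \<subseteq> {0, 2, 3}"
    and "0 \<in> A \<longleftrightarrow> 0 \<in> B" "3 \<in> A \<longleftrightarrow> 3 \<in> B"
  shows "w \<in> H k (A \<inter> B)"
proof -
  have "w \<in> H k {0, 1, 3}" using assms(2,4) by (rule H_mono)
  moreover have "w \<in> H k {0, 2, 3}" using assms(3,5) by (rule H_mono)
  ultimately have "w \<in> H k {0, 3}" by (rule H_Int_013_023)
  have "1 \<in> {0, 1, 2, 3 :: nat}" "1 \<notin> {0, 3 :: nat}" by simp_all
  then have strict: "{0, 3} \<subset> {0, 1, 2, 3 :: nat}" by blast
  define D where "D = {0, 3} - (if 0 \<in> A then {} else {0 :: nat})"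
  have w: "w \<in> H k D"
  proof (cases "0 \<in> A")
    case True
    with \<open>w \<in> H k {0, 3}\<close> show ?thesis unfolding D_def by simp
  next
    case False
    then have "D = {0, 3} - {0}" unfolding D_def by simp
    with H_drop_0[OF \<open>w \<in> H k {0, 3}\<close> H_fix_1[OF assms(2) False] strict] show ?thesis
      by (simp only:)
  qed
  show ?thesis
  proof (cases "3 \<in> A")
    case True
    have "D \<subseteq> A \<inter> B" using True assms(6,7) unfolding D_def by auto
    with w show ?thesis by (rule H_mono)
  next
    case False
    have "w \<in> H k {0, 1, 2}"
      using assms(2) by (rule H_mono) (use assms(4) False in auto)
    moreover have "D \<subseteq> {0, 3}" unfolding D_def by blast
    then have "D \<subset> {0, 1, 2, 3}" using strict by (rule subset_psubset_trans)
    ultimately have "w \<in> H k (D - {3})" by (rule H_drop_3[OF assms(1) w])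
    then show ?thesis by (rule H_mono) (use assms(6) in \<open>auto simp: D_def split: if_splits\<close>)
  qed
qed

text \<open>Extreme indices present in only one of the two sets are removed first. The remaining
  sets agree on 0 and 3, so they are nested or differ by 1 against 2.\<close>

lemma H_Int:
  assumes k: "1 \<le> k" and J: "J \<subseteq> {0, 1, 2, 3}" and K: "K \<subseteq> {0, 1, 2, 3}"
  shows "H k J \<inter> H k K = H k (J \<inter> K)"
proof
  show "H k (J \<inter> K) \<subseteq> H k J \<inter> H k K" by (auto elim: H_mono)
  show "H k J \<inter> H k K \<subseteq> H k (J \<inter> K)"
  proof
    fix w assume "w \<in> H k J \<inter> H k K"
    then have w: "w \<in> H k J" "w \<in> H k K" by auto
    show "w \<in> H k (J \<inter> K)"
    proof (cases "J = {0, 1, 2, 3} \<or> K = {0, 1, 2, 3}")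
      case True
      then have "J \<inter> K = K \<or> J \<inter> K = J" using J K by blast
      with w show ?thesis by auto
    next
      case False
      have drop_0: "w \<in> H k (A - ({0} - B))" if "w \<in> H k A" "w \<in> H k B" "A \<subset> {0, 1, 2, 3}" for A B
      proof (cases "0 \<in> B")
        case False
        then have "A - ({0} - B) = A - {0}" by auto
        with H_drop_0[OF that(1) H_fix_1[OF that(2) False] that(3)] show ?thesis by simp
      qed (use that in simp)
      have drop_3: "w \<in> H k (A - ({3} - B))"
        if "w \<in> H k A" "w \<in> H k B" "A \<subset> {0, 1, 2, 3}" "B \<subseteq> {0, 1, 2, 3}" for A B
      proof (cases "3 \<in> B")
        case False
        have "w \<in> H k {0, 1, 2}"
          using that(2) by (rule H_mono) (use that(4) False in auto)
        then have "w \<in> H k (A - {3})" by (rule H_drop_3[OF k that(1) _ that(3)])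
        moreover have "A - ({3} - B) = A - {3}" using False by auto
        ultimately show ?thesis by simp
      qed (use that in simp)
      define J1 K1 where "J1 = J - ({0} - K)" and "K1 = K - ({0} - J)"
      \<comment> \<open>Index 3 is compared after the removal of 0; \<open>w\<close> stays in both
        parabolic subgroups throughout.\<close>
      define J2 K2 where "J2 = J1 - ({3} - K1)" and "K2 = K1 - ({3} - J1)"
      note defs = J2_def K2_def J1_def K1_def
      have J': "J \<subset> {0, 1, 2, 3}" and K': "K \<subset> {0, 1, 2, 3}" using J K False by blast+
      have w1: "w \<in> H k J1" "w \<in> H k K1"
        unfolding J1_def K1_def by (rule drop_0[OF w J'], rule drop_0[OF w(2,1) K'])
      have J1: "J1 \<subset> {0, 1, 2, 3}" and K1: "K1 \<subset> {0, 1, 2, 3}"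
        unfolding J1_def K1_def by (rule subset_psubset_trans[OF Diff_subset J'],
          rule subset_psubset_trans[OF Diff_subset K'])
      have w2: "w \<in> H k J2" "w \<in> H k K2"
        unfolding J2_def K2_def
        by (rule drop_3[OF w1 J1 psubset_imp_subset[OF K1]],
          rule drop_3[OF w1(2,1) K1 psubset_imp_subset[OF J1]])
      have "J2 \<inter> K2 \<subseteq> J \<inter> K" unfolding defs by blast
      moreover have "w \<in> H k (J2 \<inter> K2)"
      proof -
        have iff: "0 \<in> J2 \<longleftrightarrow> 0 \<in> K2" "3 \<in> J2 \<longleftrightarrow> 3 \<in> K2" unfolding defs by auto
        have sub: "J2 \<subseteq> {0, 1, 2, 3}" "K2 \<subseteq> {0, 1, 2, 3}" using J K unfolding defs by auto
        consider "J2 \<subseteq> K2" | "K2 \<subseteq> J2" | "2 \<notin> J2" "1 \<notin> K2" | "1 \<notin> J2" "2 \<notin> K2"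
          using iff sub by blast
        then show ?thesis
        proof cases
          case 1
          then have "J2 \<inter> K2 = J2" by blast
          with w2 show ?thesis by simp
        next
          case 2
          then have "J2 \<inter> K2 = K2" by blast
          with w2 show ?thesis by simp
        next
          case 3
          then have "J2 \<subseteq> {0, 1, 3}" "K2 \<subseteq> {0, 2, 3}" using sub by auto
          with w2 iff show ?thesis by (intro H_Int_core[OF k])
        next
          case 4
          then have "K2 \<subseteq> {0, 1, 3}" "J2 \<subseteq> {0, 2, 3}" using sub by auto
          with w2 iff have "w \<in> H k (K2 \<inter> J2)" by (intro H_Int_core[OF k]) auto
          then show ?thesis by (simp add: Int_commute)
        qed
      qed
      ultimately show ?thesis by (rule H_mono[rotated])
    qed
  qed
qed

section \<open>Transfer to the group of the theorem\<close>

lemma pow_eq_funpow: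
  assumes "group G" "mult G = (\<circ>)" "one G = id"
  shows "x [^]\<^bsub>G\<^esub> (m :: nat) = x ^^ m"
proof (induction m)
  case 0
  interpret group G by fact
  show ?case using nat_pow_0[of x] assms(3) by simp
next
  case (Suc m)
  interpret group G by fact
  show ?case using nat_pow_Suc[of x m] Suc unfolding assms(2) funpow_Suc_right by simp
qed

theorem theorem4p4:
  fixes n :: nat
  assumes "n \<ge> 16" and "n mod 4 = 0"
  shows "thm44_group n \<cong> alt_group n
    \<and> string_C_group (thm44_group n) (thm44_rho n) 4
    \<and> schlafli_type (thm44_group n) (thm44_rho n) 4 = [3, 12, lcm (n - 8) 6]"
proof -
  define k where "k = n div 2 - 6"
  have n: "n = 2 * k + 12" and "1 \<le> k" and "even k"
    unfolding k_def using assms by presburger+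
  let ?A = "alt_group n"
  have rho: "thm44_rho n = rho k" unfolding n by (rule thm44_rho_eq)
  have four: "{..<4} = {0, 1, 2, 3 :: nat}" by auto
  \<comment> \<open>Stated for any \<open>G\<close> because it is applied to
    \<open>sym_group n\<close>, where the group is defined, and to
    \<open>alt_group n\<close>.\<close>
  have gen: "generate G (thm44_rho n ` J) = H k J"
    if "group G" "mult G = (\<circ>)" "one G = id" "rho k ` J \<subseteq> carrier G" for G :: "(nat \<Rightarrow> nat) monoid" and J
    unfolding rho using that by (intro generate_eq_products) (auto simp: rho_rho)
  have "rho k ` {..<4} \<subseteq> carrier (sym_group n)"
    using rho_permutes unfolding n by (auto simp: sym_group_carrier)
  then have carrier: "generate (sym_group n) (thm44_rho n ` {..<4}) = carrier ?A"
    using gen[OF sym_group_is_group sym_group_mult sym_group_one]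
      H_eq_alt[OF \<open>1 \<le> k\<close> \<open>even k\<close>] unfolding n by simp
  \<comment> \<open>Both are \<open>sym_group n\<close> with a new carrier, so they are equal as
    monoids and the isomorphism is the identity.\<close>
  have eq: "thm44_group n = ?A"
    unfolding thm44_group_def carrier by (simp add: alt_group_def)
  interpret A: group ?A by (rule alt_group_is_group)
  note mult = alt_group_mult[of n] and one = alt_group_one[of n]
  have in_A: "rho k j \<in> carrier ?A" for j
    using rho_permutes evenperm_rho[OF \<open>even k\<close>] unfolding n by (simp add: alt_group_carrier)
  have gen_A: "generate ?A (thm44_rho n ` J) = H k J" for J
    using in_A by (intro gen A.group_axioms mult one) blast
  have ne: "rho k i \<noteq> id" if "i < 4" for i
  proof -
    have "i = 0 \<or> i = 1 \<or> i = 2 \<or> i = 3" using that by auto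
    moreover have "r0 1 \<noteq> 1" "r1 2 \<noteq> 2" "r2 k 3 \<noteq> 3" "r3 k 4 \<noteq> 4" by simp_all
    ultimately show ?thesis by (metis id_apply rho_simps)
  qed
  have "sggi ?A (thm44_rho n) 4"
    unfolding sggi_def gen_A
  proof (intro conjI allI impI)
    show "group ?A" by (rule A.group_axioms)
    fix i :: nat
    assume i: "i < 4"
    show "thm44_rho n i \<in> carrier ?A" "thm44_rho n i \<noteq> \<one>\<^bsub>?A\<^esub>"
      "thm44_rho n i \<otimes>\<^bsub>?A\<^esub> thm44_rho n i = \<one>\<^bsub>?A\<^esub>"
      unfolding rho mult one by (rule in_A ne[OF i] rho_rho)+
    fix j assume "j < 4" "i + 2 \<le> j \<or> j + 2 \<le> i"
    then have "rho k i \<circ> rho k j = rho k j \<circ> rho k i"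
      using rho_commute[of i j k] rho_commute[of j i k] by auto
    then have "rho k j \<circ> rho k i = rho k i \<circ> rho k j" by simp
    moreover have "(rho k i \<circ> rho k j) \<circ> (rho k i \<circ> rho k j) = rho k i \<circ> (rho k j \<circ> rho k i) \<circ> rho k j"
      by (simp only: comp_assoc)
    ultimately have "(rho k i \<circ> rho k j) \<circ> (rho k i \<circ> rho k j) = rho k i \<circ> (rho k i \<circ> rho k j) \<circ> rho k j"
      by simp
    also have "\<dots> = (rho k i \<circ> rho k i) \<circ> (rho k j \<circ> rho k j)" by (simp only: comp_assoc)
    finally show "(thm44_rho n i \<otimes>\<^bsub>?A\<^esub> thm44_rho n j) \<otimes>\<^bsub>?A\<^esub> (thm44_rho n i \<otimes>\<^bsub>?A\<^esub> thm44_rho n j) = \<one>\<^bsub>?A\<^esub>"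
      unfolding rho mult one by (simp add: rho_rho)
  next
    show "H k {..<4} = carrier ?A" using H_eq_alt[OF \<open>1 \<le> k\<close> \<open>even k\<close>] unfolding n .
  qed
  moreover have "intersection_property ?A (thm44_rho n) 4"
    unfolding intersection_property_def gen_A four using H_Int[OF \<open>1 \<le> k\<close>] by blast
  moreover have "schlafli_type ?A (thm44_rho n) 4 = [3, 12, lcm (n - 8) 6]"
  proof -
    have ord: "A.ord (rho k i \<circ> rho k j) = d"
      if "\<And>m. (rho k i \<circ> rho k j) ^^ m = id \<longleftrightarrow> d dvd m" for i j d
    proof -
      have "rho k i \<circ> rho k j \<in> carrier ?A"
        using A.m_closed[OF in_A in_A] unfolding mult .
      then show ?thesis
        using A.ord_unique that pow_eq_funpow[OF A.group_axioms mult one] one by metis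
    qed
    have "A.ord (rho k 0 \<circ> rho k 1) = 3" by (rule ord) (simp only: rho_simps r0_r1_order)
    moreover have "A.ord (rho k 1 \<circ> rho k 2) = 12" by (rule ord) (simp only: rho_simps r1_r2_order)
    moreover have "A.ord (rho k 2 \<circ> rho k 3) = lcm (n - 8) 6"
    proof (rule ord)
      have "n - 8 = 2 * k + 4" unfolding n by simp
      then show "(rho k 2 \<circ> rho k 3) ^^ m = id \<longleftrightarrow> lcm (n - 8) 6 dvd m" for m
        unfolding rho_simps lcm_least_iff by (simp only: r2_r3_order[OF \<open>1 \<le> k\<close>])
    qed
    moreover have "[1..<4] = [1, 2, 3 :: nat]" by (simp add: upt_rec)
    ultimately show ?thesis
      unfolding schlafli_type_def rho mult by (simp flip: One_nat_def)
  qed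
  ultimately show ?thesis
    unfolding eq string_C_group_def by simp
qed

end
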